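(* Let $n\ge1$. A relation $\rho$ on $\mathcal{I}^{\ast}_n$ is a congruence if and only if $\rho=\rho_{k,A}=\iota_{\mathcal{I}^{\ast}_n}\cup F_k(A)\cup(I_k\times I_k)$ for some $k$ with $1\le k\le n$ and some normal subgroup $A\lhd\mathcal{S}_{k+1}$.
   Context: Let $X=\{1,\dots,n\}$, $X'=\{1',\dots,n'\}$. $\mathcal{I}^{\ast}_n$ is the set of partitions of $X\cup X'$ all of whose blocks meet both $X$ and $X'$, with product: regard $\alpha$ as a partition of $X\cup X''$ and $\beta$ as a partition of $X''\cup X'$ ($X''$ a third copy of $X$), and let $\alpha\beta$ be the partition of $X\cup X'$ induced by the equivalence on $X\cup X''\cup X'$ generated by the blocks of both; it is an inverse semigroup. The rank of an element is its number of blocks; $I_k=\{a:\mathrm{rank}(a)\le k\}$; $D_m$ = set of elements of rank $m$ ($D_{n+1}=\varnothing$); $\iota$ denotes the identity relation. For an idempotent $e$ of rank $m$, the $\mathcal{H}$-class $H_e$ is isomorphic to $\mathcal{S}_m$; for $A\lhd\mathcal{S}_m$ let $A_e$ be the unique normal subgroup of $H_e$ isomorphic to $A$, and $N_m(A)$ the union of the $A_e$ over all idempotents $e$ of rank $m$ ($N_{n+1}(A)=\varnothing$). $F_k(A)$ is the relation on $D_{k+1}$: $(x,y)\in F_k(A)$ iff $x\mathcal{H}y$ and $xy^{-1}\in N_{k+1}(A)$. *)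

theory Defs
  imports "HOL-Algebra.Sym_Groups"
begin

text \<open>Points of X \<union> X': Inl i is i \<in> X, Inr i is i' \<in> X'. An element of the dual
symmetric inverse monoid is a partition (set of blocks) of X \<union> X' each of whose
blocks meets both X and X'.\<close>

type_synonym dpart = "(nat + nat) set set"

definition dX :: "nat \<Rightarrow> (nat + nat) set" where
  "dX n = Inl ` {1..n}"

definition dX' :: "nat \<Rightarrow> (nat + nat) set" where
  "dX' n = Inr ` {1..n}"

definition dsim :: "nat \<Rightarrow> dpart set" where
  "dsim n = {P. (\<Union>P = dX n \<union> dX' n) \<and> {} \<notin> P \<and>
      (\<forall>B\<in>P. \<forall>C\<in>P. B \<noteq> C \<longrightarrow> B \<inter> C = {}) \<and>
      (\<forall>B\<in>P. B \<inter> dX n \<noteq> {} \<and> B \<inter> dX' n \<noteq> {})}"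

text \<open>Product: alpha is placed on X \<union> X'' (tags 0,1), beta on X'' \<union> X' (tags 1,2);
join the blocks, take the generated equivalence, and restrict to X \<union> X'.\<close>

fun emb_left :: "nat + nat \<Rightarrow> nat \<times> nat" where
  "emb_left (Inl i) = (0, i)" | "emb_left (Inr i) = (1, i)"

fun emb_right :: "nat + nat \<Rightarrow> nat \<times> nat" where
  "emb_right (Inl i) = (1, i)" | "emb_right (Inr i) = (2, i)"

fun emb_outer :: "nat + nat \<Rightarrow> nat \<times> nat" where
  "emb_outer (Inl i) = (0, i)" | "emb_outer (Inr i) = (2, i)"

definition joint_rel :: "dpart \<Rightarrow> dpart \<Rightarrow> ((nat \<times> nat) \<times> (nat \<times> nat)) set" where
  "joint_rel a b = {(x, y). \<exists>B \<in> (image emb_left ` a) \<union> (image emb_right ` b). x \<in> B \<and> y \<in> B}"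

definition dmult :: "nat \<Rightarrow> dpart \<Rightarrow> dpart \<Rightarrow> dpart" where
  "dmult n a b = (\<lambda>x. {p \<in> dX n \<union> dX' n.
       (emb_outer p, emb_outer x) \<in> (joint_rel a b)\<^sup>*}) ` (dX n \<union> dX' n)"

definition dinv :: "nat \<Rightarrow> dpart \<Rightarrow> dpart" where
  "dinv n x = (THE y. y \<in> dsim n \<and> dmult n (dmult n x y) x = x \<and> dmult n (dmult n y x) y = y)"

definition drank :: "dpart \<Rightarrow> nat" where
  "drank a = card a"

definition Ideal_k :: "nat \<Rightarrow> nat \<Rightarrow> dpart set" where
  "Ideal_k n k = {a \<in> dsim n. drank a \<le> k}"

definition Dcl :: "nat \<Rightarrow> nat \<Rightarrow> dpart set" where
  "Dcl n m = {a \<in> dsim n. drank a = m}"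

definition idem :: "nat \<Rightarrow> dpart \<Rightarrow> bool" where
  "idem n e \<longleftrightarrow> e \<in> dsim n \<and> dmult n e e = e"

text \<open>Green's H relation (I*_n is a monoid, so S^1 = S).\<close>
definition Hrel :: "nat \<Rightarrow> dpart \<Rightarrow> dpart \<Rightarrow> bool" where
  "Hrel n x y \<longleftrightarrow> x \<in> dsim n \<and> y \<in> dsim n \<and>
     (\<exists>s\<in>dsim n. x = dmult n y s) \<and> (\<exists>t\<in>dsim n. y = dmult n x t) \<and>
     (\<exists>s\<in>dsim n. x = dmult n s y) \<and> (\<exists>t\<in>dsim n. y = dmult n t x)"

definition Hclass :: "nat \<Rightarrow> dpart \<Rightarrow> dpart set" where
  "Hclass n e = {x. Hrel n x e}"

definition Hgroup :: "nat \<Rightarrow> dpart \<Rightarrow> dpart monoid" where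
  "Hgroup n e = \<lparr>carrier = Hclass n e, monoid.mult = dmult n, one = e\<rparr>"

definition A_at :: "nat \<Rightarrow> nat \<Rightarrow> (nat \<Rightarrow> nat) set \<Rightarrow> dpart \<Rightarrow> dpart set" where
  "A_at n m A e = (THE N. N \<lhd> Hgroup n e \<and>
       ((Hgroup n e)\<lparr>carrier := N\<rparr> \<cong> (sym_group m)\<lparr>carrier := A\<rparr>))"

definition Nset :: "nat \<Rightarrow> nat \<Rightarrow> (nat \<Rightarrow> nat) set \<Rightarrow> dpart set" where
  "Nset n m A = \<Union>{A_at n m A e | e. idem n e \<and> drank e = m}"

definition Frel :: "nat \<Rightarrow> nat \<Rightarrow> (nat \<Rightarrow> nat) set \<Rightarrow> (dpart \<times> dpart) set" where
  "Frel n k A = {(x, y). x \<in> Dcl n (k + 1) \<and> y \<in> Dcl n (k + 1) \<and> Hrel n x y \<and>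
       dmult n x (dinv n y) \<in> Nset n (k + 1) A}"

definition rho :: "nat \<Rightarrow> nat \<Rightarrow> (nat \<Rightarrow> nat) set \<Rightarrow> (dpart \<times> dpart) set" where
  "rho n k A = Id_on (dsim n) \<union> Frel n k A \<union> (Ideal_k n k \<times> Ideal_k n k)"

definition dcongruence :: "nat \<Rightarrow> (dpart \<times> dpart) set \<Rightarrow> bool" where
  "dcongruence n r \<longleftrightarrow> equiv (dsim n) r \<and>
     (\<forall>a b c. (a, b) \<in> r \<and> c \<in> dsim n \<longrightarrow>
        (dmult n a c, dmult n b c) \<in> r \<and> (dmult n c a, dmult n c b) \<in> r)"

end

(* A block bijection is determined by the pairs (U, V) such that U + V is a union of its blocks.
   This turns products into composition of injective partial maps on subsets of X, so that
   associativity, inverses and the behaviour of the rank under multiplication become properties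
   of relational composition.  Elements of rank m are written J p q, where p and q are surjections
   of X onto {1..m} and the i-th block is the union of the fibres of i; then J p q * J q s = J p s,
   and J p q = J p' q' iff (p', q') arises from (p, q) by a permutation of {1..m}.  In these
   coordinates F_k(A) relates J p q to J (\<sigma> p) q for \<sigma> in A.

   For a congruence let k be the largest rank occurring in the class of the zero element, which is
   then I_k.  If an idempotent e of rank m > k were related to something whose product with e has
   smaller rank, then e would be related to an idempotent below it of minimal rank r > 1;
   conjugating that idempotent by a suitable transposition in H_e and multiplying would lower r
   further.  Hence related elements of rank m > k are H-related, and multiplying by idempotents of
   rank m - 1 that merge two blocks forces m = k + 1 unless they are equal. *)

theory Submission
  imports Defs
begin

section \<open>Normal subgroups of symmetric groups\<close>

text \<open>\<open>A_at\<close> is a definite description, so before any semigroup argument one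
  needs that isomorphic normal subgroups of a symmetric group are equal. They are told apart by
  3-cycles. The commutator of a permutation with a transposition is a product of two transpositions,
  often a 3-cycle. A 3-cycle forces the alternating group; without one, every nonidentity element is
  a fixed-point-free involution, and then \<open>m\<close> is at most 4. For a congruence, the
  obstacle is to show that no rank is lost above \<open>k\<close>. An idempotent of rank
  \<open>r\<close> below \<open>e\<close>, with 1 < r < m, identifies two labels i, j and separates
  them from some l. Conjugating by the transposition of j and l changes its kernel, and a product of
  two idempotents of equal rank keeps that rank only if their kernels agree. The argument stops at r
  = 1, where the idempotent is the zero; this is where m > k is used. Merging two labels shows that
  a permutation relating elements of rank m > k + 1 preserves every pair of labels. As k is at least
  1, there are at least three labels, and such a permutation is the identity.\<close>

lemma sym_normal_iff:
  "N \<lhd> sym_group m \<longleftrightarrow> N \<subseteq> {p. p permutes {1..m}} \<and> id \<in> N \<and> (\<forall>s\<in>N. \<forall>t\<in>N. s \<circ> t \<in> N) \<and>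
     (\<forall>s\<in>N. inv' s \<in> N) \<and> (\<forall>s\<in>N. \<forall>t. t permutes {1..m} \<longrightarrow> t \<circ> s \<circ> inv' t \<in> N)"
  (is "?L \<longleftrightarrow> ?R")
proof -
  interpret G: group "sym_group m" by (rule sym_group_is_group)
  have inv: "inv\<^bsub>sym_group m\<^esub> s = inv' s" if "s permutes {1..m}" for s
    using that by (simp add: sym_group_carrier)
  show ?thesis
  proof
    assume L: ?L
    then have sg: "subgroup N (sym_group m)" by (rule normal_imp_subgroup)
    have sub: "N \<subseteq> {p. p permutes {1..m}}"
      using subgroup.subset[OF sg] by (simp add: sym_group_def)
    have "\<forall>s\<in>N. \<forall>t. t permutes {1..m} \<longrightarrow> t \<circ> s \<circ> inv' t \<in> N"
    proof (intro ballI allI impI)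
      fix s t assume "s \<in> N" and t: "t permutes {1..m}"
      then show "t \<circ> s \<circ> inv' t \<in> N"
        using normal.inv_op_closed2[OF L, of t s] inv[OF t] by (simp add: sym_group_carrier sym_group_mult)
    qed
    moreover have "\<forall>s\<in>N. inv' s \<in> N"
      using subgroup.m_inv_closed[OF sg] inv sub by fastforce
    ultimately show ?R
      using sub subgroup.one_closed[OF sg] subgroup.m_closed[OF sg]
      by (simp add: sym_group_one sym_group_mult)
  next
    assume R: ?R
    have "subgroup N (sym_group m)"
    proof (rule G.subgroupI)
      show "N \<subseteq> carrier (sym_group m)" using R by (simp add: sym_group_def)
    next
      fix a assume "a \<in> N"
      then show "inv\<^bsub>sym_group m\<^esub> a \<in> N" using inv[of a] R by auto
    qed (use R in \<open>auto simp: sym_group_mult\<close>)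
    then show ?L
      unfolding G.normal_inv_iff using R inv by (auto simp: sym_group_carrier sym_group_mult)
  qed
qed

lemma conj_transpose:
  assumes "bij s"
  shows "s \<circ> transpose i j \<circ> inv' s = transpose (s i) (s j)"
proof
  fix x
  obtain y where y: "x = s y" using assms by (metis bij_pointE)
  have "inj s" using assms by (rule bij_is_inj)
  then show "(s \<circ> transpose i j \<circ> inv' s) x = transpose (s i) (s j) x"
    unfolding y by (auto simp: transpose_def inj_eq)
qed

text \<open>With t the transposition of i and j, this element is the commutator of s and t:
  normality puts the conjugate of \<open>inv' s\<close> by t into N, and s t s^-1 is again a
  transposition. It is the source of all elements of small support below.\<close>

lemma normal_commutator:
  assumes N: "N \<lhd> sym_group m" and s: "s \<in> N" and i: "i \<in> {1..m}" and j: "j \<in> {1..m}"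
  shows "transpose (s i) (s j) \<circ> transpose i j \<in> N"
proof -
  note N' = N[unfolded sym_normal_iff]
  have "bij s" using N' s permutes_bij by blast
  have tr: "transpose i j permutes {1..m}" using i j by (simp add: permutes_swap_id)
  have "transpose i j \<circ> inv' s \<circ> inv' (transpose i j) \<in> N" using N' s tr by blast
  then have "s \<circ> (transpose i j \<circ> inv' s \<circ> inv' (transpose i j)) \<in> N" using N' s by blast
  moreover have "s \<circ> (transpose i j \<circ> inv' s \<circ> inv' (transpose i j)) =
      (s \<circ> transpose i j \<circ> inv' s) \<circ> transpose i j"
    by (simp add: o_assoc)
  ultimately show ?thesis using conj_transpose[OF \<open>bij s\<close>, of i j] by simp
qed

text \<open>For distinct points this is the cycle a -> b -> c -> a, factored in the same way as
  \<open>cycle_of_list [a, b, c]\<close>.\<close>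

definition cyc3 :: "'a \<Rightarrow> 'a \<Rightarrow> 'a \<Rightarrow> 'a \<Rightarrow> 'a" where
  "cyc3 a b c = transpose a b \<circ> transpose b c"

lemma conj_cyc3:
  assumes "bij s"
  shows "s \<circ> cyc3 a b c \<circ> inv' s = cyc3 (s a) (s b) (s c)"
proof -
  have i: "inv' s \<circ> s = id" using assms by (simp add: bij_is_inj)
  have "s \<circ> cyc3 a b c \<circ> inv' s = s \<circ> transpose a b \<circ> (inv' s \<circ> s) \<circ> transpose b c \<circ> inv' s"
    unfolding cyc3_def i by (simp add: o_assoc)
  also have "\<dots> = (s \<circ> transpose a b \<circ> inv' s) \<circ> (s \<circ> transpose b c \<circ> inv' s)"
    by (simp add: o_assoc)
  finally show ?thesis by (simp add: conj_transpose assms cyc3_def)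
qed

text \<open>Three transpositions suffice: each one corrects the value at one point and leaves the
  values already corrected alone.\<close>

lemma ex_permutes3:
  assumes "finite A" "a \<in> A" "b \<in> A" "c \<in> A" "a' \<in> A" "b' \<in> A" "c' \<in> A"
    and "distinct [a, b, c]" "distinct [a', b', c']"
  shows "\<exists>t. t permutes A \<and> t a = a' \<and> t b = b' \<and> t c = c'"
proof -
  define t1 where "t1 = transpose a a'"
  define t2 where "t2 = transpose (t1 b) b'"
  define t3 where "t3 = transpose (t2 (t1 c)) c'"
  have p1: "t1 permutes A" and p2: "t2 permutes A" and p3: "t3 permutes A"
    using assms(1-7) by (auto simp: t1_def t2_def t3_def transpose_def intro!: permutes_swap_id)
  have i: "inj t1" "inj t2" "inj t3" using p1 p2 p3 permutes_inj by blast+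
  have 1: "t1 a = a'" by (simp add: t1_def)
  have "t1 b \<noteq> a'" "t1 c \<noteq> a'" "t1 c \<noteq> t1 b" using 1 i(1) assms(8) by (auto simp: inj_eq dest: injD)
  then have 2: "t2 a' = a'" "t2 (t1 b) = b'" "t2 (t1 c) \<noteq> b'" "t2 (t1 c) \<noteq> a'"
    using assms(9) by (auto simp: t2_def transpose_def)
  then have 3: "t3 a' = a'" "t3 b' = b'" "t3 (t2 (t1 c)) = c'"
    using assms(9) by (auto simp: t3_def transpose_def)
  have "t3 \<circ> (t2 \<circ> t1) permutes A" using p1 p2 p3 by (intro permutes_compose)
  then show ?thesis using 1 2 3 by (intro exI[of _ "t3 \<circ> (t2 \<circ> t1)"]) simp
qed

lemma normal_all_cyc3:
  assumes N: "N \<lhd> sym_group m" and c: "cyc3 a b c \<in> N" "distinct [a, b, c]" "{a, b, c} \<subseteq> {1..m}"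
    and c': "distinct [a', b', c']" "{a', b', c'} \<subseteq> {1..m}"
  shows "cyc3 a' b' c' \<in> N"
proof -
  obtain t where t: "t permutes {1..m}" "t a = a'" "t b = b'" "t c = c'"
    using ex_permutes3[of "{1..m}" a b c a' b' c'] c c' by auto
  have "t \<circ> cyc3 a b c \<circ> inv' t \<in> N" using N[unfolded sym_normal_iff] c(1) t(1) by blast
  then show ?thesis using conj_cyc3[OF permutes_bij[OF t(1)]] t by simp
qed

text \<open>All 3-cycles are conjugate in the symmetric group, and they generate the alternating
  group.\<close>

lemma normal_contains_alt:
  assumes N: "N \<lhd> sym_group m" and c: "cyc3 a b c \<in> N" "distinct [a, b, c]" "{a, b, c} \<subseteq> {1..m}"
  shows "carrier (alt_group m) \<subseteq> N"
proof -
  have "three_cycles m \<subseteq> N"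
  proof
    fix p assume "p \<in> three_cycles m"
    then obtain cs where cs: "p = cycle_of_list cs" "distinct cs" "length cs = 3" "set cs \<subseteq> {1..m}"
      by auto
    then obtain x y z where xyz: "cs = [x, y, z]"
      using stupid_lemma by blast
    then have "p = cyc3 x y z" using cs by (simp add: cyc3_def)
    then show "p \<in> N" using normal_all_cyc3[OF N c, of x y z] cs xyz by simp
  qed
  moreover have "x \<in> N" if "x \<in> generate (alt_group m) (three_cycles m)" "three_cycles m \<subseteq> N" for x
    using that(1)
  proof (induction rule: generate.induct)
    case one show ?case unfolding alt_group_one using N[unfolded sym_normal_iff] by blast
  next
    case (incl h) then show ?case using that(2) by blast
  next
    case (inv h)
    then have "h \<in> carrier (alt_group m)" using three_cycles_incl by blast
    then have "inv\<^bsub>alt_group m\<^esub> h = inv' h" by (rule alt_group_inv_equality)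
    then show ?case using inv that(2) N[unfolded sym_normal_iff] by auto
  next
    case (eng h1 h2)
    then show ?case unfolding alt_group_mult using N[unfolded sym_normal_iff] by blast
  qed
  ultimately show ?thesis using alt_group_carrier_as_three_cycles by blast
qed

lemma cyc3_order:
  assumes "distinct [a, b, c]"
  shows "cyc3 a b c \<circ> cyc3 a b c \<noteq> id"
proof
  assume "cyc3 a b c \<circ> cyc3 a b c = id"
  then have "(cyc3 a b c \<circ> cyc3 a b c) a = a" by simp
  then show False using assms by (auto simp: cyc3_def transpose_def split: if_splits)
qed

text \<open>If s (s x) differs from x for a moved point x, the commutator of s with the
  transposition of x and s x is a 3-cycle. If s fixes i and moves x, the commutator with the
  transposition of i and x is a 3-cycle. Without 3-cycles, neither can happen.\<close>

lemma normal_cases: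
  assumes N: "N \<lhd> sym_group m"
  obtains (cyc) a b c where "cyc3 a b c \<in> N" "distinct [a, b, c]" "{a, b, c} \<subseteq> {1..m}"
  | (fpf) "\<forall>s\<in>N. s \<noteq> id \<longrightarrow> (\<forall>i\<in>{1..m}. s i \<noteq> i \<and> s (s i) = i)"
proof (cases "\<exists>a b c. cyc3 a b c \<in> N \<and> distinct [a, b, c] \<and> {a, b, c} \<subseteq> {1..m}")
  case True
  then show thesis using cyc by blast
next
  case F: False
  have "s i \<noteq> i \<and> s (s i) = i" if s: "s \<in> N" "s \<noteq> id" and i: "i \<in> {1..m}" for s i
  proof -
    have sp: "s permutes {1..m}" using s N[unfolded sym_normal_iff] by blast
    then have inj: "s x = s y \<longleftrightarrow> x = y" for x y using permutes_inj by (metis injD)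
    have si: "s x \<in> {1..m}" if "x \<in> {1..m}" for x using that unfolding permutes_in_image[OF sp] .
    have inv: "s (s x) = x" if x: "x \<in> {1..m}" "s x \<noteq> x" for x
    proof (rule ccontr)
      assume ne: "s (s x) \<noteq> x"
      have "transpose (s x) (s (s x)) \<circ> transpose x (s x) \<in> N"
        by (rule normal_commutator[OF N s(1) x(1) si[OF x(1)]])
      also have "transpose (s x) (s (s x)) \<circ> transpose x (s x) = cyc3 (s (s x)) (s x) x"
        by (simp add: cyc3_def transpose_commute)
      finally have "cyc3 (s (s x)) (s x) x \<in> N" .
      moreover have "distinct [s (s x), s x, x]" using ne x inj by simp
      moreover have "{s (s x), s x, x} \<subseteq> {1..m}" using x si by blast
      ultimately show False using F by blast
    qed
    have "s i \<noteq> i"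
    proof
      assume fixed: "s i = i"
      obtain x where x: "s x \<noteq> x" using s(2) by (metis eq_id_iff)
      then have xm: "x \<in> {1..m}" using sp by (metis permutes_def)
      have "transpose (s i) (s x) \<circ> transpose i x \<in> N"
        by (rule normal_commutator[OF N s(1) i xm])
      also have "transpose (s i) (s x) \<circ> transpose i x = cyc3 (s x) i x"
        by (simp add: fixed cyc3_def transpose_commute)
      finally have "cyc3 (s x) i x \<in> N" .
      moreover have "distinct [s x, i, x]" using fixed x inj[of x i] by auto
      moreover have "{s x, i, x} \<subseteq> {1..m}" using xm i si by blast
      ultimately show False using F by blast
    qed
    then show ?thesis using inv i by blast
  qed
  then show thesis using fpf by blast
qed

text \<open>On five points there is room for k outside the s-orbit of i and for l outside the orbits
  of i and k. The commutator of s with the transposition of i and k then moves i but fixes l, which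
  a fixed-point-free element cannot do.\<close>

lemma normal_fpf_small:
  assumes N: "N \<lhd> sym_group m" and f: "\<forall>s\<in>N. s \<noteq> id \<longrightarrow> (\<forall>i\<in>{1..m}. s i \<noteq> i \<and> s (s i) = i)"
    and s: "s \<in> N" "s \<noteq> id"
  shows "m \<le> 4"
proof (rule ccontr)
  assume "\<not> m \<le> 4"
  have sp: "s permutes {1..m}" using s N[unfolded sym_normal_iff] by blast
  have inj: "s x = s y \<longleftrightarrow> x = y" for x y using permutes_inj[OF sp] by (metis injD)
  have si: "s x \<in> {1..m}" if "x \<in> {1..m}" for x using that unfolding permutes_in_image[OF sp] .
  have ex: "\<exists>k\<in>{1..m}. k \<notin> A" if "finite A" "card A \<le> 4" for A
  proof -
    have "\<not> {1..m} \<subseteq> A" using that \<open>\<not> m \<le> 4\<close> card_mono[of A "{1..m}"] by auto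
    then show ?thesis by blast
  qed
  define i where "i = (1::nat)"
  have i: "i \<in> {1..m}" using \<open>\<not> m \<le> 4\<close> by (simp add: i_def)
  have "card {i, s i} \<le> 4" using card_insert_le_m1[of 4 "{s i}" i] by (simp add: card_insert_if)
  then obtain k where k: "k \<in> {1..m}" "k \<notin> {i, s i}" using ex[of "{i, s i}"] by auto
  have "card {i, s i, k, s k} \<le> 4" by (simp add: card_insert_if)
  then obtain l where l: "l \<in> {1..m}" "l \<notin> {i, s i, k, s k}" using ex[of "{i, s i, k, s k}"] by auto
  define t where "t = transpose (s i) (s k) \<circ> transpose i k"
  have t: "t \<in> N" unfolding t_def by (rule normal_commutator[OF N s(1) i k(1)])
  have "t l = l" using l by (simp add: t_def)
  moreover have "s k \<noteq> i" "s i \<noteq> i" using f s i k by fastforce+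
  then have "t i \<noteq> i" using k inj by (auto simp: t_def transpose_def)
  ultimately show False using f t l by fastforce
qed

text \<open>The transposition of s 1 and t 1 fixes 1, so it carries the orbit of 1 under s to that
  under t. For any other x, both v (s x) and t (v x) avoid the three points 1, t 1 and v x; among
  four points only one value is left for them.\<close>

lemma fpf_involutions_conj:
  assumes s: "s permutes {1..m}" "\<forall>i\<in>{1..m}. s i \<noteq> i \<and> s (s i) = i"
    and t: "t permutes {1..m}" "\<forall>i\<in>{1..m}. t i \<noteq> i \<and> t (t i) = i"
    and m: "m \<le> 4" "0 < (m::nat)"
  shows "\<exists>u. u permutes {1..m} \<and> t = u \<circ> s \<circ> inv' u"
proof -
  define v where "v = transpose (s 1) (t 1)"
  have one: "1 \<in> {1..m}" using m by simp
  have s1: "s 1 \<in> {1..m}" "s 1 \<noteq> 1" and t1: "t 1 \<in> {1..m}" "t 1 \<noteq> 1"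
    using s t one permutes_in_image[OF s(1), of 1] permutes_in_image[OF t(1), of 1] by auto
  have v: "v permutes {1..m}" unfolding v_def by (intro permutes_swap_id s1 t1)
  have v1: "v 1 = 1" "v (s 1) = t 1" using s1 t1 by (auto simp: v_def transpose_def)
  have injs: "s x = s y \<longleftrightarrow> x = y" and injt: "t x = t y \<longleftrightarrow> x = y"
    and injv: "v x = v y \<longleftrightarrow> x = y" for x y
    using permutes_inj s(1) t(1) v by (metis injD)+
  have eq: "v (s x) = t (v x)" for x
  proof (cases "x \<in> {1..m}")
    case False
    then show ?thesis using s(1) t(1) v by (simp add: permutes_not_in)
  next
    case True
    consider "x = 1" | "x = s 1" | "x \<noteq> 1" "x \<noteq> s 1" by blast
    then show ?thesis
    proof cases
      case 3
      let ?A = "{1, t 1, v x}"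
      have vx: "v x \<in> {1..m}" using True permutes_in_image[OF v] by metis
      have vsx: "v (s x) \<in> {1..m}" and tvx: "t (v x) \<in> {1..m}"
        using True vx permutes_in_image[OF v] permutes_in_image[OF s(1)] permutes_in_image[OF t(1)] by metis+
      have d: "v x \<noteq> 1" "v x \<noteq> t 1" using 3 v1 injv by metis+
      have "s x \<noteq> 1" "s x \<noteq> s 1" "s x \<noteq> x"
        using 3 s(2) True injs by metis+
      then have a: "v (s x) \<notin> ?A" using v1 injv by (metis insertE singletonD)
      have "t (v x) \<noteq> 1" "t (v x) \<noteq> t 1" "t (v x) \<noteq> v x"
        using d t(2) vx injt by metis+
      then have b: "t (v x) \<notin> ?A" by blast
      have c: "card ?A = 3" using d t1 by (simp add: card_insert_if)
      show ?thesis
      proof (rule ccontr)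
        assume ne: "v (s x) \<noteq> t (v x)"
        have "card (insert (v (s x)) (insert (t (v x)) ?A)) = 5"
          using a b c ne by (subst card_insert_disjoint; simp)+
        moreover have "insert (v (s x)) (insert (t (v x)) ?A) \<subseteq> {1..m}"
          using vx vsx tvx t1 one by blast
        ultimately have "5 \<le> card {1..m}" by (metis card_mono finite_atLeastAtMost)
        then show False using m by simp
      qed
    qed (use v1 s(2) t(2) one in auto)
  qed
  have "t = v \<circ> s \<circ> inv' v"
  proof
    fix x
    obtain y where y: "x = v y" using permutes_surj[OF v] by (metis surjD)
    show "t x = (v \<circ> s \<circ> inv' v) x" using eq[of y] permutes_inj[OF v] by (simp add: y)
  qed
  then show ?thesis using v by blast
qed

text \<open>One nonidentity element brings in all its conjugates, which are all the fixed-point-free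
  involutions. The right-hand side depends on \<open>m\<close> alone, so two nontrivial subgroups of
  this kind coincide.\<close>

lemma sym_fpf_eq:
  assumes N: "N \<lhd> sym_group m" and f: "\<forall>s\<in>N. s \<noteq> id \<longrightarrow> (\<forall>i\<in>{1..m}. s i \<noteq> i \<and> s (s i) = i)"
    and ne: "N \<noteq> {id}"
  shows "N = {id} \<union> {t. t permutes {1..m} \<and> (\<forall>i\<in>{1..m}. t i \<noteq> i \<and> t (t i) = i)}"
proof -
  note N' = N[unfolded sym_normal_iff]
  obtain s where s: "s \<in> N" "s \<noteq> id" using ne N' by blast
  have sp: "s permutes {1..m}" using s N' by blast
  have m: "m \<le> 4" by (rule normal_fpf_small[OF N f s])
  have m0: "0 < m"
  proof (rule ccontr)
    assume "\<not> 0 < m" then have "s = id" using sp by (simp add: permutes_empty)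
    then show False using s by simp
  qed
  have "t \<in> N" if t: "t permutes {1..m}" "\<forall>i\<in>{1..m}. t i \<noteq> i \<and> t (t i) = i" for t
  proof -
    obtain u where "u permutes {1..m}" "t = u \<circ> s \<circ> inv' u"
      using fpf_involutions_conj[OF sp _ t m m0] f s by blast
    then show ?thesis using N' s by blast
  qed
  then show ?thesis using N' f by blast
qed

text \<open>The alternating group has index at most 2: an odd t is s composed with the even
  permutation s^-1 t for any odd s in N.\<close>

lemma normal_alt_cases:
  assumes N: "N \<lhd> sym_group m" and sub: "carrier (alt_group m) \<subseteq> N"
  shows "N = carrier (alt_group m) \<or> N = carrier (sym_group m)"
proof (cases "N = carrier (alt_group m)")
  case False
  note N' = N[unfolded sym_normal_iff]
  obtain s where s: "s \<in> N" "\<not> evenperm s" using False sub N' by (metis alt_group_carrier mem_Collect_eq subsetD subset_antisym subsetI)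
  have sp: "s permutes {1..m}" using s N' by blast
  have "t \<in> N" if t: "t permutes {1..m}" for t
  proof (cases "evenperm t")
    case True then show ?thesis using t sub by (auto simp: alt_group_carrier)
  next
    case False
    have perm: "permutation s" "permutation t" using sp t permutation_permutes by blast+
    have "evenperm (inv' s \<circ> t)"
      using False s perm by (simp add: evenperm_comp evenperm_inv permutation_inverse)
    moreover have "inv' s \<circ> t permutes {1..m}" using sp t by (intro permutes_compose permutes_inv)
    ultimately have "inv' s \<circ> t \<in> N" using sub by (auto simp: alt_group_carrier)
    then have "s \<circ> (inv' s \<circ> t) \<in> N" using N' s by blast
    then show ?thesis using permutes_inv_o(1)[OF sp] by (simp add: o_assoc)
  qed
  then show ?thesis using N' by (auto simp: sym_group_carrier)
qed simp

text \<open>This makes the description in the definition of \<open>A_at\<close> definite. A subgroup containing a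
3-cycle is not isomorphic to one without, since every element of the latter squares to the
identity.\<close>
lemma sym_group_normal_iso_eq:
  assumes A: "A \<lhd> sym_group m" and B: "B \<lhd> sym_group m"
    and iso: "(sym_group m)\<lparr>carrier := A\<rparr> \<cong> (sym_group m)\<lparr>carrier := B\<rparr>"
  shows "A = B"
proof -
  have fin: "finite A" "finite B"
    using A B finite_permutations[of "{1..m}"] unfolding sym_normal_iff by (auto intro: finite_subset)
  have card: "card A = card B" using iso_same_card[OF iso] by simp
  have no: False
    if A: "A \<lhd> sym_group m" and c: "cyc3 a b c \<in> A" "distinct [a, b, c]"
      and B: "B \<lhd> sym_group m" and f: "\<forall>s\<in>B. s \<noteq> id \<longrightarrow> (\<forall>i\<in>{1..m}. s i \<noteq> i \<and> s (s i) = i)"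
      and iso: "(sym_group m)\<lparr>carrier := A\<rparr> \<cong> (sym_group m)\<lparr>carrier := B\<rparr>" for A B a b c
  proof -
    obtain h where h: "h \<in> hom ((sym_group m)\<lparr>carrier := A\<rparr>) ((sym_group m)\<lparr>carrier := B\<rparr>)"
      and bij: "bij_betw h A B"
      using iso unfolding is_iso_def iso_def by auto
    have hm: "h (x \<circ> y) = h x \<circ> h y" if "x \<in> A" "y \<in> A" for x y
      using hom_mult[OF h] that by (simp add: sym_group_mult)
    have hB: "h x \<in> B" if "x \<in> A" for x using bij that by (auto simp: bij_betw_def)
    have sq: "t \<circ> t = id" if "t \<in> B" for t
    proof
      have "t permutes {1..m}" using B that unfolding sym_normal_iff by blast
      then show "(t \<circ> t) x = id x" for x
        using f that by (cases "x \<in> {1..m}") (auto simp: permutes_not_in)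
    qed
    let ?c = "cyc3 a b c"
    have idA: "id \<in> A" and cc: "?c \<circ> ?c \<in> A" using A c unfolding sym_normal_iff by blast+
    have "h (?c \<circ> ?c) = id" using hm[OF c(1) c(1)] sq[OF hB[OF c(1)]] by simp
    moreover have "h id = id" using hm[OF idA idA] sq[OF hB[OF idA]] by simp
    ultimately have "?c \<circ> ?c = id" using bij idA cc by (metis bij_betw_imp_inj_on inj_onD)
    then show False using cyc3_order[OF c(2)] by blast
  qed
  have iso': "(sym_group m)\<lparr>carrier := B\<rparr> \<cong> (sym_group m)\<lparr>carrier := A\<rparr>"
    using iso group.iso_sym subgroup.subgroup_is_group[OF normal_imp_subgroup[OF A] sym_group_is_group] by blast
  show ?thesis
  proof (cases rule: normal_cases[OF A])
    case (1 a b c)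
    note cA = 1
    show ?thesis
    proof (cases rule: normal_cases[OF B])
      case (1 a' b' c')
      have subs: "carrier (alt_group m) \<subseteq> A" "carrier (alt_group m) \<subseteq> B"
        using normal_contains_alt[OF A cA] normal_contains_alt[OF B 1] .
      \<comment> \<open>Each subgroup is the alternating or the full symmetric group, and one of
        these contains the other, so equal cardinality decides.\<close>
      show ?thesis
        using normal_alt_cases[OF A subs(1)] normal_alt_cases[OF B subs(2)] subs card fin
        by (metis card_subset_eq)
    next
      case 2
      then show ?thesis using no[OF A cA(1,2) B _ iso] by blast
    qed
  next
    case 2
    note fA = 2
    show ?thesis
    proof (cases rule: normal_cases[OF B])
      case (1 a' b' c')
      then show ?thesis using no[OF B 1(1,2) A fA iso'] by blast
    next
      case 2
      \<comment> \<open>Cardinality tells whether both are trivial; if not, both equal the set in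
        \<open>sym_fpf_eq\<close>.\<close>
      show ?thesis
      proof (cases "A = {id}")
        case True
        then have "card B = 1" "id \<in> B" using card B unfolding sym_normal_iff by auto
        then show ?thesis using True by (metis card_1_singletonE singletonD)
      next
        case False
        then have "B \<noteq> {id}" using card A fin unfolding sym_normal_iff
          by (metis One_nat_def card.empty card.insert card_1_singletonE empty_iff finite.emptyI singletonD)
        then show ?thesis using sym_fpf_eq[OF A fA False] sym_fpf_eq[OF B 2] by simp
      qed
    qed
  qed
qed

section \<open>Block bijections as partial maps on subsets\<close>

definition sat :: "nat \<Rightarrow> dpart \<Rightarrow> (nat set \<times> nat set) set" where
  "sat n a = {(U, V). U \<subseteq> {1..n} \<and> V \<subseteq> {1..n} \<and> (\<forall>B\<in>a. B \<subseteq> U <+> V \<or> B \<inter> (U <+> V) = {})}"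

abbreviation pts :: "nat \<Rightarrow> (nat + nat) set" where
  "pts n \<equiv> {1..n} <+> {1..n}"

lemma dX_Un: "dX n \<union> dX' n = pts n"
  by (auto simp: dX_def dX'_def)

lemma dsim_iff:
  "a \<in> dsim n \<longleftrightarrow> \<Union>a = pts n \<and> (\<forall>B\<in>a. \<forall>C\<in>a. B \<noteq> C \<longrightarrow> B \<inter> C = {}) \<and>
     (\<forall>B\<in>a. (\<exists>i. Inl i \<in> B) \<and> (\<exists>j. Inr j \<in> B))"
proof -
  have "B \<inter> dX n \<noteq> {} \<and> B \<inter> dX' n \<noteq> {} \<longleftrightarrow> (\<exists>i. Inl i \<in> B) \<and> (\<exists>j. Inr j \<in> B)"
    if "B \<subseteq> pts n" for B
    using that by (auto simp: dX_def dX'_def)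
  moreover have "B \<subseteq> pts n" if "B \<in> a" "\<Union>a = pts n" for B
    using that by blast
  moreover have "{} \<notin> a" if "\<forall>B\<in>a. (\<exists>i. Inl i \<in> B) \<and> (\<exists>j. Inr j \<in> B)"
    using that by blast
  ultimately show ?thesis
    unfolding dsim_def mem_Collect_eq dX_Un by meson
qed

lemma Plus_vimage: "Inl -` B <+> Inr -` B = B"
proof (rule Set.set_eqI)
  show "x \<in> Inl -` B <+> Inr -` B \<longleftrightarrow> x \<in> B" for x by (cases x) auto
qed

lemma dsim_block_sub: "\<lbrakk>a \<in> dsim n; B \<in> a\<rbrakk> \<Longrightarrow> B \<subseteq> pts n"
  unfolding dsim_iff by blast

lemma dsim_block_eq: "\<lbrakk>a \<in> dsim n; B \<in> a; C \<in> a; x \<in> B; x \<in> C\<rbrakk> \<Longrightarrow> B = C"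
  unfolding dsim_iff by blast

lemma dsim_block_ex: "\<lbrakk>a \<in> dsim n; x \<in> pts n\<rbrakk> \<Longrightarrow> \<exists>B\<in>a. x \<in> B"
  by (metis UnionE dsim_iff)

lemma dsim_block_meets:
  assumes "a \<in> dsim n" "B \<in> a"
  shows "\<exists>i\<in>{1..n}. Inl i \<in> B" "\<exists>j\<in>{1..n}. Inr j \<in> B"
proof -
  obtain i j where "Inl i \<in> B" "Inr j \<in> B" using assms unfolding dsim_iff by meson
  then show "\<exists>i\<in>{1..n}. Inl i \<in> B" "\<exists>j\<in>{1..n}. Inr j \<in> B"
    using dsim_block_sub[OF assms] by blast+
qed

lemma sat_iff_block:
  assumes "(U, V) \<in> sat n a" "B \<in> a" "x \<in> B" "y \<in> B"
  shows "x \<in> U <+> V \<longleftrightarrow> y \<in> U <+> V"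
  using assms by (auto simp: sat_def)

lemma satI:
  assumes "U \<subseteq> {1..n}" "V \<subseteq> {1..n}"
    and "\<And>B x y. \<lbrakk>B \<in> a; x \<in> B; y \<in> B; x \<in> U <+> V\<rbrakk> \<Longrightarrow> y \<in> U <+> V"
  shows "(U, V) \<in> sat n a"
  using assms unfolding sat_def by blast

lemma sat_block:
  assumes a: "a \<in> dsim n" and B: "B \<in> a"
  shows "(Inl -` B, Inr -` B) \<in> sat n a"
  unfolding sat_def mem_Collect_eq case_prod_conv Plus_vimage
  using dsim_block_sub[OF a B] dsim_block_eq[OF a B] by blast

text \<open>A block of \<open>a\<close> gives a saturated pair of \<open>a\<close>, hence of
  \<open>b\<close>, so it contains any block of \<open>b\<close> that it meets. Exchanging the roles
  makes the two blocks equal.\<close>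

lemma sat_inj_aux:
  assumes a: "a \<in> dsim n" and b: "b \<in> dsim n" and eq: "sat n a = sat n b"
  shows "a \<subseteq> b"
proof
  fix B assume B: "B \<in> a"
  then obtain x where x: "x \<in> B" using a by (auto simp: dsim_iff)
  then have "x \<in> \<Union>b" using a b B by (auto simp: dsim_iff)
  then obtain C where C: "C \<in> b" "x \<in> C" by blast
  have "C \<subseteq> B"
    using sat_iff_block[OF sat_block[OF a B, unfolded eq] C] x unfolding Plus_vimage by blast
  moreover have "B \<subseteq> C"
    using sat_iff_block[OF sat_block[OF b C(1), folded eq] B x] C unfolding Plus_vimage by blast
  ultimately show "B \<in> b" using C by simp
qed

lemma sat_inj:
  assumes "a \<in> dsim n" "b \<in> dsim n" "sat n a = sat n b"
  shows "a = b"
  using sat_inj_aux assms by blast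

section \<open>The product as composition of relations between subsets\<close>

lemma sym_joint: "sym ((joint_rel a b)\<^sup>*)"
  by (rule sym_rtrancl) (auto simp: joint_rel_def sym_def)

lemma joint_leftI: "\<lbrakk>B \<in> a; x \<in> B; y \<in> B\<rbrakk> \<Longrightarrow> (emb_left x, emb_left y) \<in> joint_rel a b"
  unfolding joint_rel_def by blast

lemma joint_rightI: "\<lbrakk>B \<in> b; x \<in> B; y \<in> B\<rbrakk> \<Longrightarrow> (emb_right x, emb_right y) \<in> joint_rel a b"
  unfolding joint_rel_def by blast

lemma joint_symD: "(x, y) \<in> (joint_rel a b)\<^sup>* \<Longrightarrow> (y, x) \<in> (joint_rel a b)\<^sup>*"
  using sym_joint by (metis symD)

lemma dmult_iff_block:
  assumes "B \<in> dmult n a b" "x \<in> B" "y \<in> B"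
  shows "(emb_outer x, emb_outer y) \<in> (joint_rel a b)\<^sup>*"
  using assms unfolding dmult_def dX_Un by (auto intro: rtrancl_trans joint_symD)

lemma dmult_closed:
  assumes a: "a \<in> dsim n" and b: "b \<in> dsim n"
  shows "dmult n a b \<in> dsim n"
proof -
  let ?R = "(joint_rel a b)\<^sup>*"
  let ?cl = "\<lambda>x. {p \<in> pts n. (emb_outer p, emb_outer x) \<in> ?R}"
  have D: "dmult n a b = ?cl ` pts n"
    by (simp add: dmult_def dX_Un)
  have cover: "\<Union>(?cl ` pts n) = pts n" by blast
  have disj: "\<forall>B\<in>?cl ` pts n. \<forall>C\<in>?cl ` pts n. B \<noteq> C \<longrightarrow> B \<inter> C = {}"
  proof (intro ballI impI)
    fix B C assume "B \<in> ?cl ` pts n" "C \<in> ?cl ` pts n" "B \<noteq> C"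
    then obtain x y where xy: "B = ?cl x" "C = ?cl y" by blast
    show "B \<inter> C = {}"
    proof (rule ccontr)
      assume "B \<inter> C \<noteq> {}"
      then obtain z where "(emb_outer z, emb_outer x) \<in> ?R" "(emb_outer z, emb_outer y) \<in> ?R"
        unfolding xy by blast
      then have xRy: "(emb_outer x, emb_outer y) \<in> ?R" by (meson joint_symD rtrancl_trans)
      then have "B = C" unfolding xy by (meson joint_symD rtrancl_trans)
      with \<open>B \<noteq> C\<close> show False by blast
    qed
  qed
  have blk: "\<exists>B\<in>c. x \<in> B \<and> (\<exists>i\<in>{1..n}. Inl i \<in> B) \<and> (\<exists>j\<in>{1..n}. Inr j \<in> B)"
    if c: "c \<in> dsim n" and xn: "x \<in> pts n" for c x
  proof -
    obtain B where B: "B \<in> c" "x \<in> B" using dsim_block_ex[OF c xn] by blast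
    then show ?thesis using dsim_block_meets[OF c B(1)] by blast
  qed
  \<comment> \<open>From a point on one side, a block of one factor leads to the middle copy, and
    the block of the other factor through that middle point leads to the opposite side. The point is
    shared because \<open>emb_left (Inr j)\<close> and \<open>emb_right (Inl j)\<close> are
    equal.\<close>
  have meet: "(\<exists>i. Inl i \<in> ?cl x) \<and> (\<exists>j. Inr j \<in> ?cl x)" if x: "x \<in> pts n" for x
  proof (cases x)
    case (Inl i)
    obtain B j where B: "B \<in> a" "x \<in> B" "Inr j \<in> B" "j \<in> {1..n}" using blk[OF a x] by blast
    then have 1: "(emb_left x, emb_left (Inr j)) \<in> joint_rel a b" by (blast intro: joint_leftI)
    obtain C l where C: "C \<in> b" "Inl j \<in> C" "Inr l \<in> C" "l \<in> {1..n}"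
      using blk[OF b, of "Inl j"] B by blast
    then have 2: "(emb_right (Inl j), emb_right (Inr l)) \<in> joint_rel a b" by (blast intro: joint_rightI)
    have "(emb_outer x, emb_outer (Inr l)) \<in> ?R"
      using 1 2 Inl by (auto intro: rtrancl_trans)
    then have "Inr l \<in> ?cl x" using C(4) by (auto intro: joint_symD)
    moreover have "Inl i \<in> ?cl x" using x Inl by auto
    ultimately show ?thesis by blast
  next
    case (Inr i)
    obtain B j where B: "B \<in> b" "x \<in> B" "Inl j \<in> B" "j \<in> {1..n}" using blk[OF b x] by blast
    then have 1: "(emb_right x, emb_right (Inl j)) \<in> joint_rel a b" by (blast intro: joint_rightI)
    obtain C l where C: "C \<in> a" "Inr j \<in> C" "Inl l \<in> C" "l \<in> {1..n}"
      using blk[OF a, of "Inr j"] B by blast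
    then have 2: "(emb_left (Inr j), emb_left (Inl l)) \<in> joint_rel a b" by (blast intro: joint_leftI)
    have "(emb_outer x, emb_outer (Inl l)) \<in> ?R"
      using 1 2 Inr by (auto intro: rtrancl_trans)
    then have "Inl l \<in> ?cl x" using C(4) by (auto intro: joint_symD)
    moreover have "Inr i \<in> ?cl x" using x Inr by auto
    ultimately show ?thesis by blast
  qed
  show ?thesis
    unfolding D dsim_iff
  proof (intro conjI)
    show "\<forall>B\<in>?cl ` pts n. (\<exists>i. Inl i \<in> B) \<and> (\<exists>j. Inr j \<in> B)"
      using meet by (simp only: ball_simps) (rule ballI)
  qed (fact cover, fact disj)
qed

lemma joint_invariant:
  assumes "(x, y) \<in> (joint_rel a b)\<^sup>*"
    and "\<And>B x y. \<lbrakk>B \<in> a; x \<in> B; y \<in> B\<rbrakk> \<Longrightarrow> emb_left x \<in> W \<longleftrightarrow> emb_left y \<in> W"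
    and "\<And>B x y. \<lbrakk>B \<in> b; x \<in> B; y \<in> B\<rbrakk> \<Longrightarrow> emb_right x \<in> W \<longleftrightarrow> emb_right y \<in> W"
  shows "x \<in> W \<longleftrightarrow> y \<in> W"
  using assms(1)
proof (induction rule: rtrancl_induct)
  case (step y z)
  then have "y \<in> W \<longleftrightarrow> z \<in> W"
    using assms(2,3) unfolding joint_rel_def by blast
  with step show ?case by simp
qed simp

text \<open>A set in the three-layer picture is a union of classes of the generated equivalence iff
  each factor saturates its own two layers. The middle layer of such a set is the intermediate set
  of the relational composition.\<close>

lemma sat_dmult:
  assumes a: "a \<in> dsim n" and b: "b \<in> dsim n"
  shows "sat n (dmult n a b) = sat n a O sat n b"
proof (intro Set.set_eqI iffI)
  fix UV assume "UV \<in> sat n (dmult n a b)"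
  then obtain U V where UV: "UV = (U, V)" and s: "(U, V) \<in> sat n (dmult n a b)"
    by (cases UV) auto
  have UVn: "U \<subseteq> {1..n}" "V \<subseteq> {1..n}" using s by (auto simp: sat_def)
  let ?R = "(joint_rel a b)\<^sup>*"
  \<comment> \<open>\<open>W\<close> is the saturation of the outer set in all three layers and
    \<open>T\<close> its trace on the middle layer. The saturation adds no outer points, because
    outer points that become equivalent lie in one block of the product.\<close>
  define W where "W = {z. \<exists>x\<in>U <+> V. (z, emb_outer x) \<in> ?R}"
  define T where "T = {t\<in>{1..n}. (1, t) \<in> W}"
  have W: "emb_outer x \<in> W \<longleftrightarrow> x \<in> U <+> V" if x: "x \<in> pts n" for x
  proof
    assume "emb_outer x \<in> W"
    then obtain y where y: "y \<in> U <+> V" "(emb_outer x, emb_outer y) \<in> ?R"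
      unfolding W_def by blast
    have y': "y \<in> pts n" using y UVn by auto
    let ?B = "{p \<in> pts n. (emb_outer p, emb_outer y) \<in> ?R}"
    have "?B \<in> dmult n a b" using y' by (auto simp: dmult_def dX_Un)
    then show "x \<in> U <+> V"
      using sat_iff_block[OF s, of ?B x y] x y y' by blast
  qed (auto simp: W_def)
  have Wc: "z \<in> W \<longleftrightarrow> z' \<in> W" if "(z, z') \<in> joint_rel a b" for z z'
  proof -
    have zz: "(z, z') \<in> ?R" using that by blast
    have "(z, w) \<in> ?R \<longleftrightarrow> (z', w) \<in> ?R" for w
      using zz joint_symD[OF zz] by (meson rtrancl_trans)
    then show ?thesis by (simp add: W_def)
  qed
  have left: "emb_left x \<in> W \<longleftrightarrow> x \<in> U <+> T" if "x \<in> pts n" for x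
    using W[OF that] that by (cases x) (auto simp: T_def)
  have right: "emb_right x \<in> W \<longleftrightarrow> x \<in> T <+> V" if "x \<in> pts n" for x
    using W[OF that] that by (cases x) (auto simp: T_def)
  have inp: "x \<in> pts n" if "c \<in> dsim n" "B \<in> c" "x \<in> B" for x B c
    using dsim_block_sub that by blast
  have "(U, T) \<in> sat n a"
  proof (rule satI)
    fix B x y assume "B \<in> a" "x \<in> B" "y \<in> B" "x \<in> U <+> T"
    then show "y \<in> U <+> T"
      using left Wc joint_leftI inp[OF a] by metis
  qed (use UVn in \<open>auto simp: T_def\<close>)
  moreover have "(T, V) \<in> sat n b"
  proof (rule satI)
    fix B x y assume "B \<in> b" "x \<in> B" "y \<in> B" "x \<in> T <+> V"
    then show "y \<in> T <+> V"
      using right Wc joint_rightI inp[OF b] by metis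
  qed (use UVn in \<open>auto simp: T_def\<close>)
  ultimately show "UV \<in> sat n a O sat n b" using UV by blast
next
  fix UV assume "UV \<in> sat n a O sat n b"
  then obtain U T V where UV: "UV = (U, V)" and sa: "(U, T) \<in> sat n a" and sb: "(T, V) \<in> sat n b"
    by blast
  \<comment> \<open>Conversely, stacking the three sets gives a set that the blocks of both factors
    respect, and hence the generated equivalence does too.\<close>
  define W where "W = ({0} \<times> U \<union> {1} \<times> T \<union> {2} \<times> V :: (nat \<times> nat) set)"
  have l: "emb_left x \<in> W \<longleftrightarrow> x \<in> U <+> T" and r: "emb_right x \<in> W \<longleftrightarrow> x \<in> T <+> V"
    and o: "emb_outer x \<in> W \<longleftrightarrow> x \<in> U <+> V" for x
    by (cases x; auto simp: W_def)+
  have inv: "x \<in> W \<longleftrightarrow> y \<in> W" if "(x, y) \<in> (joint_rel a b)\<^sup>*" for x y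
    using that by (rule joint_invariant) (use l r sat_iff_block[OF sa] sat_iff_block[OF sb] in blast)+
  have "(U, V) \<in> sat n (dmult n a b)"
  proof (rule satI)
    fix B x y assume "B \<in> dmult n a b" "x \<in> B" "y \<in> B" "x \<in> U <+> V"
    then show "y \<in> U <+> V"
      using dmult_iff_block inv o by metis
  qed (use sa sb in \<open>auto simp: sat_def\<close>)
  then show "UV \<in> sat n (dmult n a b)" using UV by simp
qed

lemma dmult_assoc:
  assumes "a \<in> dsim n" "b \<in> dsim n" "c \<in> dsim n"
  shows "dmult n (dmult n a b) c = dmult n a (dmult n b c)"
  by (rule sat_inj[of _ n]) (use assms in \<open>auto simp: sat_dmult dmult_closed O_assoc\<close>)

section \<open>Elements given by a pair of labellings of the two copies of X\<close>

definition fib :: "nat \<Rightarrow> (nat \<Rightarrow> nat) \<Rightarrow> nat set \<Rightarrow> nat set" where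
  "fib n p T = {s\<in>{1..n}. p s \<in> T}"

definition onto :: "nat \<Rightarrow> nat \<Rightarrow> (nat \<Rightarrow> nat) \<Rightarrow> bool" where
  "onto n m p \<longleftrightarrow> p ` {1..n} = {1..m}"

text \<open>The labellings are total functions of which only the values on \<open>{1..n}\<close>
  count (\<open>J_cong\<close>); this is why they are later compared pointwise on
  \<open>{1..n}\<close> and not as functions.\<close>

definition J :: "nat \<Rightarrow> nat \<Rightarrow> (nat \<Rightarrow> nat) \<Rightarrow> (nat \<Rightarrow> nat) \<Rightarrow> dpart" where
  "J n m p q = (\<lambda>i. fib n p {i} <+> fib n q {i}) ` {1..m}"

lemma onto_mem: "onto n m p \<Longrightarrow> s \<in> {1..n} \<Longrightarrow> p s \<in> {1..m}"
  by (auto simp: onto_def)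

lemma onto_ex: "onto n m p \<Longrightarrow> i \<in> {1..m} \<Longrightarrow> \<exists>s\<in>{1..n}. p s = i"
  by (auto simp: onto_def image_iff) (metis image_iff atLeastAtMost_iff)

lemma J_cong:
  assumes "\<And>s. s \<in> {1..n} \<Longrightarrow> p s = p' s" "\<And>s. s \<in> {1..n} \<Longrightarrow> q s = q' s"
  shows "J n m p q = J n m p' q'"
  using assms by (simp add: J_def fib_def cong: conj_cong)

lemma J_closed:
  assumes p: "onto n m p" and q: "onto n m q"
  shows "J n m p q \<in> dsim n"
proof -
  have "\<Union>(J n m p q) = pts n"
    using onto_mem[OF p] onto_mem[OF q] unfolding J_def fib_def by (fastforce simp: Plus_def)
  moreover have "\<forall>B\<in>J n m p q. \<forall>C\<in>J n m p q. B \<noteq> C \<longrightarrow> B \<inter> C = {}"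
    unfolding J_def fib_def by auto
  moreover have "\<forall>B\<in>J n m p q. (\<exists>i. Inl i \<in> B) \<and> (\<exists>j. Inr j \<in> B)"
    using onto_ex[OF p] onto_ex[OF q] unfolding J_def fib_def by (fastforce simp: Plus_def)
  ultimately show ?thesis unfolding dsim_iff by blast
qed

lemma J_rank:
  assumes p: "onto n m p" and q: "onto n m q"
  shows "drank (J n m p q) = m"
proof -
  have "inj_on (\<lambda>i. fib n p {i} <+> fib n q {i}) {1..m}"
  proof (rule inj_onI)
    fix i j assume i: "i \<in> {1..m}" and eq: "fib n p {i} <+> fib n q {i} = fib n p {j} <+> fib n q {j}"
    obtain s where s: "s \<in> {1..n}" "p s = i" using onto_ex[OF p i] by blast
    then have "Inl s \<in> fib n p {i} <+> fib n q {i}" by (auto simp: fib_def)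
    then show "i = j" using s unfolding eq by (auto simp: fib_def)
  qed
  then show ?thesis by (simp add: drank_def J_def card_image)
qed

text \<open>The blocks are indexed by labels, so a union of blocks is a set of labels; it is
  recovered from U as the image of U under p.\<close>

lemma sat_J:
  assumes p: "onto n m p" and q: "onto n m q"
  shows "sat n (J n m p q) = (\<lambda>T. (fib n p T, fib n q T)) ` Pow {1..m}"
proof (intro Set.set_eqI iffI)
  fix UV assume "UV \<in> sat n (J n m p q)"
  then obtain U V where UV: "UV = (U, V)" and s: "(U, V) \<in> sat n (J n m p q)"
    by (cases UV) auto
  have UVn: "U \<subseteq> {1..n}" "V \<subseteq> {1..n}" using s by (auto simp: sat_def)
  have bl: "x \<in> U <+> V \<longleftrightarrow> y \<in> U <+> V"
    if "i \<in> {1..m}" "x \<in> fib n p {i} <+> fib n q {i}" "y \<in> fib n p {i} <+> fib n q {i}" for i x y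
    using sat_iff_block[OF s] that unfolding J_def by blast
  define T where "T = p ` U"
  have "U = fib n p T"
  proof
    show "fib n p T \<subseteq> U"
    proof
      fix s assume "s \<in> fib n p T"
      then obtain u where u: "s \<in> {1..n}" "u \<in> U" "p s = p u" by (auto simp: fib_def T_def)
      have "Inl s \<in> fib n p {p u} <+> fib n q {p u}" "Inl u \<in> fib n p {p u} <+> fib n q {p u}"
        using u UVn by (auto simp: fib_def)
      from bl[OF _ this] u onto_mem[OF p u(1)] show "s \<in> U" by auto
    qed
  qed (use UVn in \<open>auto simp: T_def fib_def\<close>)
  moreover have "V = fib n q T"
  proof (intro Set.set_eqI iffI)
    fix v assume v: "v \<in> V"
    then obtain u where u: "u \<in> {1..n}" "p u = q v"
      using UVn onto_ex[OF p] onto_mem[OF q] by (metis subsetD)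
    have "Inr v \<in> fib n p {q v} <+> fib n q {q v}" "Inl u \<in> fib n p {q v} <+> fib n q {q v}"
      using u v UVn by (auto simp: fib_def)
    from bl[OF _ this] u v UVn onto_mem[OF p u(1)] show "v \<in> fib n q T"
      by (auto simp: T_def fib_def intro: image_eqI[where x = u])
  next
    fix v assume "v \<in> fib n q T"
    then obtain u where u: "v \<in> {1..n}" "u \<in> U" "q v = p u" by (auto simp: fib_def T_def)
    have "Inr v \<in> fib n p {p u} <+> fib n q {p u}" "Inl u \<in> fib n p {p u} <+> fib n q {p u}"
      using u UVn by (auto simp: fib_def)
    from bl[OF _ this] u onto_mem[OF q u(1)] show "v \<in> V" by auto
  qed
  moreover have "T \<in> Pow {1..m}" using onto_mem[OF p] UVn by (auto simp: T_def)
  ultimately show "UV \<in> (\<lambda>T. (fib n p T, fib n q T)) ` Pow {1..m}" using UV by blast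
next
  fix UV assume "UV \<in> (\<lambda>T. (fib n p T, fib n q T)) ` Pow {1..m}"
  then obtain T where T: "UV = (fib n p T, fib n q T)" by blast
  have "(fib n p T, fib n q T) \<in> sat n (J n m p q)"
    by (rule satI) (auto simp: J_def fib_def)
  then show "UV \<in> sat n (J n m p q)" using T by simp
qed

lemma fib_inj:
  assumes p: "onto n m p" and "S \<subseteq> {1..m}" "T \<subseteq> {1..m}" "fib n p S = fib n p T"
  shows "S = T"
proof -
  have "S \<subseteq> T" if S: "S \<subseteq> {1..m}" "fib n p S = fib n p T" for S T
  proof
    fix i assume "i \<in> S"
    then obtain s where "s \<in> {1..n}" "p s = i" using onto_ex[OF p] S by (metis subsetD)
    then show "i \<in> T" using S \<open>i \<in> S\<close> by (auto simp: fib_def)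
  qed
  then show ?thesis using assms by (metis subset_antisym)
qed

text \<open>Number the blocks and send each point to the number of its block; p and q are the
  restrictions of this map to the two copies of X. They are surjective because each block meets both
  copies.\<close>

lemma dsim_J:
  assumes a: "a \<in> dsim n"
  obtains p q where "onto n (drank a) p" "onto n (drank a) q" "a = J n (drank a) p q"
proof -
  have "finite (\<Union>a)" using a by (auto simp: dsim_iff)
  then have "finite a" by (rule finite_UnionD)
  then obtain f where f: "bij_betw f {1..drank a} a"
    unfolding drank_def by (metis ex_bij_betw_nat_finite_1)
  have ex: "\<exists>i. i \<in> {1..drank a} \<and> x \<in> f i" if x: "x \<in> pts n" for x
  proof -
    obtain B where "B \<in> a" "x \<in> B" using dsim_block_ex[OF a x] by blast
    moreover from this f have "B \<in> f ` {1..drank a}" by (simp add: bij_betw_def)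
    ultimately show ?thesis by blast
  qed
  have uniq: "i = j" if "i \<in> {1..drank a}" "j \<in> {1..drank a}" "x \<in> f i" "x \<in> f j" for i j x
  proof -
    have "f i \<in> a" "f j \<in> a" using f that by (auto simp: bij_betw_def)
    then have "f i = f j" using dsim_block_eq[OF a] that by blast
    then show ?thesis using f that by (metis bij_betw_imp_inj_on inj_onD)
  qed
  define g where "g x = (SOME i. i \<in> {1..drank a} \<and> x \<in> f i)" for x
  have g: "g x \<in> {1..drank a}" "x \<in> f (g x)" if "x \<in> pts n" for x
    using someI_ex[OF ex[OF that]] unfolding g_def by auto
  have fsub: "f i \<subseteq> pts n" if "i \<in> {1..drank a}" for i
    using f dsim_block_sub[OF a] that unfolding bij_betw_def by blast
  have g_iff: "x \<in> f i \<longleftrightarrow> x \<in> pts n \<and> g x = i" if "i \<in> {1..drank a}" for x i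
    using uniq g fsub that by blast
  have meet: "(\<exists>s. Inl s \<in> f i) \<and> (\<exists>s. Inr s \<in> f i)" if "i \<in> {1..drank a}" for i
  proof -
    have "f i \<in> a" using f that by (auto simp: bij_betw_def)
    then show ?thesis using dsim_block_meets[OF a, of "f i"] by blast
  qed
  let ?p = "g \<circ> Inl" and ?q = "g \<circ> Inr"
  have "onto n (drank a) ?p" "onto n (drank a) ?q"
  proof -
    have "?p ` {1..n} \<subseteq> {1..drank a}" "?q ` {1..n} \<subseteq> {1..drank a}"
      using g(1)[OF InlI] g(1)[OF InrI] by auto
    moreover have "i \<in> ?p ` {1..n} \<and> i \<in> ?q ` {1..n}" if i: "i \<in> {1..drank a}" for i
    proof -
      obtain s t where "Inl s \<in> f i" "Inr t \<in> f i" using meet[OF i] by blast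
      then show ?thesis using g_iff[OF i] by force
    qed
    ultimately show "onto n (drank a) ?p" "onto n (drank a) ?q"
      unfolding onto_def by blast+
  qed
  moreover have "a = J n (drank a) ?p ?q"
  proof -
    have "f i = fib n ?p {i} <+> fib n ?q {i}" if "i \<in> {1..drank a}" for i
    proof (rule Set.set_eqI)
      show "x \<in> f i \<longleftrightarrow> x \<in> fib n ?p {i} <+> fib n ?q {i}" for x
        using g_iff[OF that, of x] by (cases x) (auto simp: fib_def)
    qed
    then have "f ` {1..drank a} = J n (drank a) ?p ?q"
      unfolding J_def by (rule image_cong[OF refl])
    then show ?thesis using f by (simp add: bij_betw_def)
  qed
  ultimately show thesis using that by blast
qed

section \<open>Coordinates given by surjections\<close>

lemma onto_comp: "\<lbrakk>onto m r h; onto n m p\<rbrakk> \<Longrightarrow> onto n r (h \<circ> p)"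
  unfolding onto_def image_comp[symmetric] by simp

lemma onto_permutes: "\<sigma> permutes {1..m} \<Longrightarrow> onto m m \<sigma>"
  unfolding onto_def by (rule permutes_image)

lemma onto_perm_comp: "\<lbrakk>\<sigma> permutes {1..m}; onto n m p\<rbrakk> \<Longrightarrow> onto n m (\<sigma> \<circ> p)"
  by (rule onto_comp[OF onto_permutes])

lemma onto_le: "onto n m p \<Longrightarrow> m \<le> n"
  unfolding onto_def by (metis card_atLeastAtMost card_image_le diff_Suc_1 finite_atLeastAtMost)

text \<open>The map that caps values at m is a concrete surjection onto fewer labels;
  \<open>Zcl_eq\<close> uses it to lower ranks.\<close>

lemma onto_min:
  assumes "1 \<le> m" "m \<le> n"
  shows "onto n m (min m)"
proof -
  have "min m ` {1..n} = {1..m}"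
  proof (intro equalityI subsetI)
    fix i assume "i \<in> {1..m}"
    then have "i = min m i" "i \<in> {1..n}" using assms(2) by auto
    then show "i \<in> min m ` {1..n}" by (rule image_eqI)
  next
    fix i assume "i \<in> min m ` {1..n}"
    then show "i \<in> {1..m}" using assms(1) by auto
  qed
  then show ?thesis by (simp add: onto_def)
qed

lemma onto_comp_eqD:
  assumes p: "onto n m p" and eq: "\<And>s. s \<in> {1..n} \<Longrightarrow> f (p s) = g (p s)" and i: "i \<in> {1..m}"
  shows "f i = g i"
  using onto_ex[OF p i] eq by blast

lemma fib_comp: "onto n m q \<Longrightarrow> fib n (h \<circ> q) T = fib n q (fib m h T)"
  using onto_mem[of n m q] by (auto simp: fib_def)

lemma fib_sub: "fib m h T \<subseteq> {1..m}"
  by (auto simp: fib_def)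

text \<open>Abstract core of the product rule: the condition f x = g y matches the parameters of the
  two factors, and the composite is parametrised by x alone.\<close>

lemma relcomp_param:
  assumes "\<And>x y. \<lbrakk>x \<in> A; y \<in> B; f x = g y\<rbrakk> \<Longrightarrow> u x = (k x :: 'a) \<and> v y = (l x :: 'b) \<and> x \<in> C"
    and "\<And>x. x \<in> C \<Longrightarrow> x \<in> A \<and> (\<exists>y\<in>B. f x = g y)"
  shows "(\<lambda>x. (u x, f x)) ` A O (\<lambda>y. (g y, v y)) ` B = (\<lambda>x. (k x, l x)) ` C"
proof (intro equalityI subsetI)
  fix z assume "z \<in> (\<lambda>x. (u x, f x)) ` A O (\<lambda>y. (g y, v y)) ` B"
  then obtain x y where "x \<in> A" "y \<in> B" "f x = g y" "z = (u x, v y)" by auto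
  then show "z \<in> (\<lambda>x. (k x, l x)) ` C" using assms(1)[of x y] by auto
next
  fix z assume "z \<in> (\<lambda>x. (k x, l x)) ` C"
  then obtain x y where xy: "x \<in> C" "x \<in> A" "y \<in> B" "f x = g y" "z = (k x, l x)"
    using assms(2) by blast
  have "(u x, f x) \<in> (\<lambda>x. (u x, f x)) ` A" using xy(2) by (rule imageI)
  moreover have "(f x, v y) \<in> (\<lambda>y. (g y, v y)) ` B" unfolding xy(4) using xy(3) by (rule imageI)
  ultimately have "(u x, v y) \<in> (\<lambda>x. (u x, f x)) ` A O (\<lambda>y. (g y, v y)) ` B" by (rule relcompI)
  then show "z \<in> (\<lambda>x. (u x, f x)) ` A O (\<lambda>y. (g y, v y)) ` B"
    using assms(1)[OF xy(2,3,4)] xy(5) by simp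
qed

text \<open>The right factor translates q-labels into s-labels, so a labelling that factors through
  q is carried to the one that factors through s by the same h. A set S of coarse labels corresponds
  to the set \<open>fib m h S\<close> of fine labels.\<close>

lemma J_mult_right:
  assumes p: "onto n r p" and q: "onto n m q" and s: "onto n m s" and h: "onto m r h"
  shows "dmult n (J n r p (h \<circ> q)) (J n m q s) = J n r p (h \<circ> s)"
proof (rule sat_inj[of _ n])
  note hq = onto_comp[OF h q] and hs = onto_comp[OF h s]
  have "sat n (J n r p (h \<circ> q)) O sat n (J n m q s) = sat n (J n r p (h \<circ> s))"
    unfolding sat_J[OF p hq] sat_J[OF q s] sat_J[OF p hs] fib_comp[OF q] fib_comp[OF s]
  proof (rule relcomp_param)
    fix S T assume "T \<in> Pow {1..m}" "fib n q (fib m h S) = fib n q T" "S \<in> Pow {1..r}"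
    moreover from this have "fib m h S = T" using fib_inj[OF q fib_sub] by blast
    ultimately show "fib n p S = fib n p S \<and> fib n s T = fib n s (fib m h S) \<and> S \<in> Pow {1..r}"
      by simp
  qed (use fib_sub in blast)
  then show "sat n (dmult n (J n r p (h \<circ> q)) (J n m q s)) = sat n (J n r p (h \<circ> s))"
    by (simp add: sat_dmult J_closed p q s hq)
qed (use onto_comp[OF h q] onto_comp[OF h s] in \<open>simp_all add: J_closed dmult_closed p q s\<close>)

lemma sat_J_converse:
  assumes p: "onto n m p" and q: "onto n m q"
  shows "sat n (J n m q p) = (sat n (J n m p q))\<inverse>"
  unfolding sat_J[OF p q] sat_J[OF q p] by auto

text \<open>Reading saturated pairs backwards swaps the two labellings and reverses products, so
  this is the converse of \<open>J_mult_right\<close>.\<close>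

lemma J_mult_left:
  assumes p: "onto n m p" and q: "onto n m q" and s: "onto n r s" and h: "onto m r h"
  shows "dmult n (J n m p q) (J n r (h \<circ> q) s) = J n r (h \<circ> p) s"
proof (rule sat_inj[of _ n])
  note hq = onto_comp[OF h q] and hp = onto_comp[OF h p]
  have "sat n (dmult n (J n r s (h \<circ> q)) (J n m q p)) = sat n (J n r s (h \<circ> p))"
    by (simp only: J_mult_right[OF s q p h])
  then have "(sat n (J n r s (h \<circ> q)) O sat n (J n m q p))\<inverse> = (sat n (J n r s (h \<circ> p)))\<inverse>"
    by (simp only: sat_dmult[OF J_closed[OF s hq] J_closed[OF q p]])
  then show "sat n (dmult n (J n m p q) (J n r (h \<circ> q) s)) = sat n (J n r (h \<circ> p) s)"
    by (simp only: converse_relcomp converse_converse sat_J_converse[OF p q]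
        sat_J_converse[OF hq s] sat_J_converse[OF hp s] sat_dmult[OF J_closed[OF p q] J_closed[OF hq s]])
qed (use onto_comp[OF h q] onto_comp[OF h p] in \<open>simp_all add: J_closed dmult_closed p q s\<close>)

lemma J_mult:
  assumes "onto n m p" "onto n m q" "onto n m s"
  shows "dmult n (J n m p q) (J n m q s) = J n m p s"
  using J_mult_right[OF assms(1,2,3) onto_permutes[OF permutes_id]] by simp

lemma J_perm:
  assumes \<sigma>: "\<sigma> permutes {1..m}" and p: "onto n m p" and q: "onto n m q"
  shows "J n m (\<sigma> \<circ> p) (\<sigma> \<circ> q) = J n m p q"
proof -
  have eq: "fib n (\<sigma> \<circ> r) {\<sigma> i} = fib n r {i}" for r i
    using permutes_inj[OF \<sigma>] by (simp add: fib_def inj_eq)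
  have "J n m (\<sigma> \<circ> p) (\<sigma> \<circ> q) =
      (\<lambda>i. fib n (\<sigma> \<circ> p) {i} <+> fib n (\<sigma> \<circ> q) {i}) ` (\<sigma> ` {1..m})"
    unfolding J_def permutes_image[OF \<sigma>] ..
  also have "\<dots> = J n m p q"
    unfolding J_def image_image eq ..
  finally show ?thesis .
qed

lemma J_perm_left:
  assumes \<sigma>: "\<sigma> permutes {1..m}" and p: "onto n m p" and q: "onto n m q"
  shows "J n m (\<sigma> \<circ> p) q = J n m p (inv' \<sigma> \<circ> q)"
  using J_perm[OF permutes_inv[OF \<sigma>] onto_perm_comp[OF \<sigma> p] q]
  by (simp add: o_assoc permutes_inv_o(2)[OF \<sigma>])

lemma J_perm_right:
  assumes \<sigma>: "\<sigma> permutes {1..m}" and p: "onto n m p" and q: "onto n m q"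
  shows "J n m p (\<sigma> \<circ> q) = J n m (inv' \<sigma> \<circ> p) q"
  using J_perm[OF permutes_inv[OF \<sigma>] p onto_perm_comp[OF \<sigma> q]]
  by (simp add: o_assoc permutes_inv_o(2)[OF \<sigma>])

lemma Domain_sat_J:
  "\<lbrakk>onto n m p; onto n m q\<rbrakk> \<Longrightarrow> Domain (sat n (J n m p q)) = fib n p ` Pow {1..m}"
  by (simp add: sat_J Domain_fst image_image)

lemma Range_sat_J:
  "\<lbrakk>onto n m p; onto n m q\<rbrakk> \<Longrightarrow> Range (sat n (J n m p q)) = fib n q ` Pow {1..m}"
  by (simp add: sat_J Range_snd image_image)

text \<open>Once the first labelling is fixed there is no freedom left to relabel blocks, which
  determines the second one.\<close>

lemma J_eqD:
  assumes p: "onto n m p" and q: "onto n m q" and q': "onto n m q'"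
    and eq: "J n m p q = J n m p q'" and s: "s \<in> {1..n}"
  shows "q s = q' s"
proof -
  let ?i = "q s"
  have i: "?i \<in> {1..m}" by (rule onto_mem[OF q s])
  have "(fib n p {?i}, fib n q {?i}) \<in> sat n (J n m p q')"
    unfolding eq[symmetric] sat_J[OF p q] using i by blast
  then obtain T where T: "T \<subseteq> {1..m}" "fib n p {?i} = fib n p T" "fib n q {?i} = fib n q' T"
    unfolding sat_J[OF p q'] by blast
  have "T = {?i}" using fib_inj[OF p _ T(1) T(2)] i by blast
  then have "s \<in> fib n q' {?i}" using s T(3) by (auto simp: fib_def)
  then show ?thesis by (simp add: fib_def)
qed

text \<open>The inclusion says that fibres of p' are unions of fibres of p, that is, that the kernel
  of p' is coarser; so p' factors through p on \<open>{1..n}\<close>.\<close>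

lemma fib_factor:
  assumes p: "onto n m p" and p': "onto n m' p'"
    and sub: "fib n p' ` Pow {1..m'} \<subseteq> fib n p ` Pow {1..m}"
  shows "\<exists>h. onto m m' h \<and> (\<forall>s\<in>{1..n}. p' s = h (p s))"
proof -
  have key: "p' s = p' t" if st: "s \<in> {1..n}" "t \<in> {1..n}" "p s = p t" for s t
  proof -
    have "{p' s} \<in> Pow {1..m'}" using onto_mem[OF p' st(1)] by simp
    then have "fib n p' {p' s} \<in> fib n p ` Pow {1..m}" using sub by (rule subsetD[rotated, OF imageI])
    then obtain T where T: "fib n p' {p' s} = fib n p T" by (rule imageE)
    have "s \<in> fib n p T" unfolding T[symmetric] using st by (simp add: fib_def)
    then have "t \<in> fib n p T" using st by (simp add: fib_def)
    then show ?thesis unfolding T[symmetric] by (simp add: fib_def)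
  qed
  define h where "h i = p' (SOME s. s \<in> {1..n} \<and> p s = i)" for i
  have h: "p' s = h (p s)" if s: "s \<in> {1..n}" for s
  proof -
    have "\<exists>t. t \<in> {1..n} \<and> p t = p s" using s by blast
    from someI_ex[OF this] show ?thesis unfolding h_def using key s by metis
  qed
  have "h ` {1..m} = h ` p ` {1..n}" using p by (simp add: onto_def)
  also have "\<dots> = p' ` {1..n}" using h by (force simp: image_image intro: image_cong)
  finally have "onto m m' h" using p' by (simp add: onto_def)
  then show ?thesis using h by blast
qed

text \<open>With equally many labels the factor map is a surjection of a finite set onto itself,
  hence a bijection.\<close>

lemma fib_factor_perm:
  assumes p: "onto n m p" and p': "onto n m p'"
    and sub: "fib n p' ` Pow {1..m} \<subseteq> fib n p ` Pow {1..m}"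
  shows "\<exists>\<sigma>. \<sigma> permutes {1..m} \<and> (\<forall>s\<in>{1..n}. p' s = \<sigma> (p s))"
proof -
  obtain h where h: "onto m m h" "\<forall>s\<in>{1..n}. p' s = h (p s)"
    using fib_factor[OF p p' sub] by blast
  \<comment> \<open>The factor map is arbitrary outside \<open>{1..m}\<close>, whereas
    \<open>permutes\<close> demands the identity there.\<close>
  define \<sigma> where "\<sigma> i = (if i \<in> {1..m} then h i else i)" for i
  have "\<sigma> ` {1..m} = h ` {1..m}" by (rule image_cong) (simp_all add: \<sigma>_def)
  then have im: "\<sigma> ` {1..m} = {1..m}" using h(1) by (simp add: onto_def)
  then have "inj_on \<sigma> {1..m}" by (intro eq_card_imp_inj_on) simp_all
  then have "\<sigma> permutes {1..m}"
    using im by (intro bij_imp_permutes) (auto simp: bij_betw_def \<sigma>_def)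
  moreover have "p' s = \<sigma> (p s)" if "s \<in> {1..n}" for s
    using h(2) that onto_mem[OF p that] by (simp add: \<sigma>_def)
  ultimately show ?thesis by blast
qed

section \<open>Rank under multiplication\<close>

lemma card_fib_image: "onto n m p \<Longrightarrow> card (fib n p ` Pow {1..m}) = 2 ^ m"
proof (subst card_image)
  show "inj_on (fib n p) (Pow {1..m})" if "onto n m p"
    using fib_inj[OF that] by (intro inj_onI) simp
qed (simp add: card_Pow)

text \<open>This expresses rank by the size of a domain, so that comparing ranks becomes comparing
  the domains of relations, which composition can only shrink.\<close>

lemma card_Domain_sat: "a \<in> dsim n \<Longrightarrow> card (Domain (sat n a)) = 2 ^ drank a"
  by (metis dsim_J Domain_sat_J card_fib_image)

lemma card_Range_sat: "a \<in> dsim n \<Longrightarrow> card (Range (sat n a)) = 2 ^ drank a"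
  by (metis dsim_J Range_sat_J card_fib_image)

lemma finite_Domain_sat: "finite (Domain (sat n a))" and finite_Range_sat: "finite (Range (sat n a))"
  by (rule finite_subset[of _ "Pow {1..n}"]; auto simp: sat_def)+

lemma drank_mult_le:
  assumes a: "a \<in> dsim n" and b: "b \<in> dsim n"
  shows "drank (dmult n a b) \<le> drank a" "drank (dmult n a b) \<le> drank b"
proof -
  note c = dmult_closed[OF a b]
  have "Domain (sat n (dmult n a b)) \<subseteq> Domain (sat n a)" "Range (sat n (dmult n a b)) \<subseteq> Range (sat n b)"
    unfolding sat_dmult[OF a b] by blast+
  then have "(2::nat) ^ drank (dmult n a b) \<le> 2 ^ drank a" "(2::nat) ^ drank (dmult n a b) \<le> 2 ^ drank b"
    using card_mono[OF finite_Domain_sat] card_mono[OF finite_Range_sat]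
    by (metis card_Domain_sat a c, metis card_Range_sat b c)
  then show "drank (dmult n a b) \<le> drank a" "drank (dmult n a b) \<le> drank b" by simp_all
qed

text \<open>If no rank is lost, the first labelling of the product is a relabelling of p; undoing it
  on both sides restores p and changes only the second labelling.\<close>

lemma drank_mult_left_eq:
  assumes p: "onto n m p" and q: "onto n m q" and b: "b \<in> dsim n"
    and r: "drank (dmult n (J n m p q) b) = m"
  obtains s where "onto n m s" "dmult n (J n m p q) b = J n m p s"
proof -
  let ?c = "dmult n (J n m p q) b"
  have c: "?c \<in> dsim n" by (intro dmult_closed J_closed p q b)
  obtain p' s where ps: "onto n m p'" "onto n m s" "?c = J n m p' s"
    using dsim_J[OF c] r by metis
  have "Domain (sat n ?c) \<subseteq> Domain (sat n (J n m p q))"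
    unfolding sat_dmult[OF J_closed[OF p q] b] by blast
  then have "fib n p' ` Pow {1..m} \<subseteq> fib n p ` Pow {1..m}"
    by (simp only: ps Domain_sat_J[OF p q] Domain_sat_J[OF ps(1,2)])
  from fib_factor_perm[OF p ps(1) this] obtain \<sigma> where \<sigma>: "\<sigma> permutes {1..m}" "\<forall>s\<in>{1..n}. p' s = \<sigma> (p s)"
    by blast
  have "?c = J n m (\<sigma> \<circ> p) s"
    unfolding ps(3) using \<sigma>(2) by (intro J_cong) simp_all
  then have "?c = J n m p (inv' \<sigma> \<circ> s)"
    by (simp only: J_perm_left[OF \<sigma>(1) p ps(2)])
  then show thesis using that onto_perm_comp[OF permutes_inv[OF \<sigma>(1)] ps(2)] by blast
qed

lemma drank_mult_right_eq:
  assumes p: "onto n m p" and q: "onto n m q" and b: "b \<in> dsim n"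
    and r: "drank (dmult n b (J n m p q)) = m"
  obtains s where "onto n m s" "dmult n b (J n m p q) = J n m s q"
proof -
  let ?c = "dmult n b (J n m p q)"
  have c: "?c \<in> dsim n" by (intro dmult_closed J_closed p q b)
  obtain s q' where ps: "onto n m s" "onto n m q'" "?c = J n m s q'"
    using dsim_J[OF c] r by metis
  have "Range (sat n ?c) \<subseteq> Range (sat n (J n m p q))"
    unfolding sat_dmult[OF b J_closed[OF p q]] by blast
  then have "fib n q' ` Pow {1..m} \<subseteq> fib n q ` Pow {1..m}"
    by (simp only: ps Range_sat_J[OF p q] Range_sat_J[OF ps(1,2)])
  from fib_factor_perm[OF q ps(2) this] obtain \<sigma> where \<sigma>: "\<sigma> permutes {1..m}" "\<forall>s\<in>{1..n}. q' s = \<sigma> (q s)"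
    by blast
  have "?c = J n m s (\<sigma> \<circ> q)"
    unfolding ps(3) using \<sigma>(2) by (intro J_cong) simp_all
  then have "?c = J n m (inv' \<sigma> \<circ> s) q"
    by (simp only: J_perm_right[OF \<sigma>(1) ps(1) q])
  then show thesis using that onto_perm_comp[OF permutes_inv[OF \<sigma>(1)] ps(1)] by blast
qed

section \<open>Injectivity of the partial maps, Green's H relation, inverses and idempotents\<close>

lemma sat_J_functional:
  assumes p: "onto n m p" and q: "onto n m q"
  shows "(U, V) \<in> sat n (J n m p q) \<Longrightarrow> (U, V') \<in> sat n (J n m p q) \<Longrightarrow> V = V'"
    and "(U, V) \<in> sat n (J n m p q) \<Longrightarrow> (U', V) \<in> sat n (J n m p q) \<Longrightarrow> U = U'"
proof -
  show "V = V'" if uv: "(U, V) \<in> sat n (J n m p q)" "(U, V') \<in> sat n (J n m p q)"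
  proof -
    obtain S T where "S \<subseteq> {1..m}" "T \<subseteq> {1..m}" "U = fib n p S" "U = fib n p T"
      "V = fib n q S" "V' = fib n q T"
      using uv unfolding sat_J[OF p q] by blast
    then show ?thesis using fib_inj[OF p] by metis
  qed
  show "U = U'" if uv: "(U, V) \<in> sat n (J n m p q)" "(U', V) \<in> sat n (J n m p q)"
  proof -
    obtain S T where "S \<subseteq> {1..m}" "T \<subseteq> {1..m}" "U = fib n p S" "U' = fib n p T"
      "V = fib n q S" "V = fib n q T"
      using uv unfolding sat_J[OF p q] by blast
    then show ?thesis using fib_inj[OF q] by metis
  qed
qed

lemma sat_functional:
  assumes "a \<in> dsim n"
  shows "(U, V) \<in> sat n a \<Longrightarrow> (U, V') \<in> sat n a \<Longrightarrow> V = V'"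
    and "(U, V) \<in> sat n a \<Longrightarrow> (U', V) \<in> sat n a \<Longrightarrow> U = U'"
proof -
  obtain p q where pq: "onto n (drank a) p" "onto n (drank a) q" "a = J n (drank a) p q"
    by (rule dsim_J[OF assms])
  show "(U, V) \<in> sat n a \<Longrightarrow> (U, V') \<in> sat n a \<Longrightarrow> V = V'"
    using sat_J_functional(1)[OF pq(1,2)] pq(3) by metis
  show "(U, V) \<in> sat n a \<Longrightarrow> (U', V) \<in> sat n a \<Longrightarrow> U = U'"
    using sat_J_functional(2)[OF pq(1,2)] pq(3) by metis
qed

text \<open>Equal rank means that the composite has the whole domain of its first factor, so every
  set in the range of the first factor lies in the domain of the second. This forces the two middle
  labellings to have the same kernel, and is the test for rank loss used throughout.\<close>

lemma drank_mult_middle: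
  assumes p: "onto n m p" and q: "onto n m q" and q': "onto n m q'" and s: "onto n m s"
    and r: "drank (dmult n (J n m p q) (J n m q' s)) = m"
  shows "\<exists>\<sigma>. \<sigma> permutes {1..m} \<and> (\<forall>s\<in>{1..n}. q s = \<sigma> (q' s))"
proof -
  let ?X = "sat n (J n m p q)" and ?Y = "sat n (J n m q' s)"
  note cl = J_closed[OF p q] J_closed[OF q' s]
  have "card (Domain (?X O ?Y)) = card (Domain ?X)"
    using card_Domain_sat[OF dmult_closed[OF cl]] card_Domain_sat[OF cl(1)] r J_rank[OF p q]
    by (simp add: sat_dmult[OF cl])
  then have dom: "Domain (?X O ?Y) = Domain ?X"
    by (intro card_subset_eq finite_Domain_sat) blast+
  have "Range ?X \<subseteq> Domain ?Y"
  proof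
    fix V assume "V \<in> Range ?X"
    then obtain U where U: "(U, V) \<in> ?X" by blast
    then obtain V' W where "(U, V') \<in> ?X" "(V', W) \<in> ?Y" using dom by blast
    then show "V \<in> Domain ?Y" using sat_functional(1)[OF cl(1) U] by blast
  qed
  then have "fib n q ` Pow {1..m} \<subseteq> fib n q' ` Pow {1..m}"
    by (simp only: Range_sat_J[OF p q] Domain_sat_J[OF q' s])
  then show ?thesis by (rule fib_factor_perm[OF q' q])
qed

text \<open>Being a right multiple without loss of rank preserves the first labelling, being a left
  multiple preserves the second. Comparing the resulting forms \<open>J n m p u\<close> and
  \<open>J n m v q\<close> of y shows that v is a relabelling of p.\<close>

lemma Hrel_J:
  assumes p: "onto n m p" and q: "onto n m q"
  shows "Hrel n y (J n m p q) \<longleftrightarrow> (\<exists>\<sigma>. \<sigma> permutes {1..m} \<and> y = J n m (\<sigma> \<circ> p) q)"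
proof
  let ?x = "J n m p q"
  note x = J_closed[OF p q]
  assume "Hrel n y ?x"
  then obtain s t s' where y: "y \<in> dsim n" and st: "s \<in> dsim n" "t \<in> dsim n" "s' \<in> dsim n"
      "y = dmult n ?x s" "?x = dmult n y t" "y = dmult n s' ?x"
    unfolding Hrel_def by blast
  have "drank y \<le> m" using drank_mult_le(1)[OF x st(1)] st(4) J_rank[OF p q] by simp
  moreover have "m \<le> drank y" using drank_mult_le(1)[OF y st(2)] st(5) J_rank[OF p q] by simp
  ultimately have r: "drank y = m" by simp
  obtain u where u: "onto n m u" "y = J n m p u"
    using drank_mult_left_eq[OF p q st(1)] st(4) r by metis
  obtain v where v: "onto n m v" "y = J n m v q"
    using drank_mult_right_eq[OF p q st(3)] st(6) r by metis
  have "fib n v ` Pow {1..m} \<subseteq> fib n p ` Pow {1..m}"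
    using Domain_sat_J[OF p u(1)] Domain_sat_J[OF v(1) q] u(2) v(2) by simp
  from fib_factor_perm[OF p v(1) this] obtain \<sigma> where \<sigma>: "\<sigma> permutes {1..m}" "\<forall>s\<in>{1..n}. v s = \<sigma> (p s)"
    by blast
  then have "y = J n m (\<sigma> \<circ> p) q" unfolding v(2) by (intro J_cong) simp_all
  then show "\<exists>\<sigma>. \<sigma> permutes {1..m} \<and> y = J n m (\<sigma> \<circ> p) q" using \<sigma>(1) by blast
next
  assume "\<exists>\<sigma>. \<sigma> permutes {1..m} \<and> y = J n m (\<sigma> \<circ> p) q"
  then obtain \<sigma> where \<sigma>: "\<sigma> permutes {1..m}" and y: "y = J n m (\<sigma> \<circ> p) q" by blast
  have y': "y = J n m p (inv' \<sigma> \<circ> q)" unfolding y by (rule J_perm_left[OF \<sigma> p q])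
  note sp = onto_perm_comp[OF \<sigma> p] and sq = onto_perm_comp[OF permutes_inv[OF \<sigma>] q]
  show "Hrel n y (J n m p q)"
    unfolding Hrel_def
  proof (intro conjI)
    show "\<exists>s\<in>dsim n. y = dmult n (J n m p q) s"
      unfolding y' using J_mult[OF p q sq] J_closed[OF q sq] by metis
    show "\<exists>t\<in>dsim n. J n m p q = dmult n y t"
      unfolding y' using J_mult[OF p sq q] J_closed[OF sq q] by metis
    show "\<exists>s\<in>dsim n. y = dmult n s (J n m p q)"
      unfolding y using J_mult[OF sp p q] J_closed[OF sp p] by metis
    show "\<exists>t\<in>dsim n. J n m p q = dmult n t y"
      unfolding y using J_mult[OF p sp q] J_closed[OF p sp] by metis
  qed (simp_all add: y J_closed p q sp)
qed

text \<open>This also shows that the description in \<open>dinv\<close> is definite: x y x = x and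
  injectivity of the partial map of x force its converse to lie in the map of y, and y x y = y gives
  the other inclusion.\<close>

lemma dinv_J:
  assumes p: "onto n m p" and q: "onto n m q"
  shows "dinv n (J n m p q) = J n m q p"
  unfolding dinv_def
proof (rule the_equality)
  show "J n m q p \<in> dsim n \<and> dmult n (dmult n (J n m p q) (J n m q p)) (J n m p q) = J n m p q \<and>
      dmult n (dmult n (J n m q p) (J n m p q)) (J n m q p) = J n m q p"
    by (simp add: J_closed J_mult p q)
next
  fix y
  let ?x = "J n m p q"
  assume y: "y \<in> dsim n \<and> dmult n (dmult n ?x y) ?x = ?x \<and> dmult n (dmult n y ?x) y = y"
  note x = J_closed[OF p q]
  have inv: "(sat n a)\<inverse> \<subseteq> sat n b"
    if a: "a \<in> dsim n" and b: "b \<in> dsim n" and eq: "dmult n (dmult n a b) a = a" for a b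
  proof
    fix VU assume "VU \<in> (sat n a)\<inverse>"
    then obtain U V where UV: "VU = (V, U)" "(U, V) \<in> sat n a" by blast
    have "sat n a = (sat n a O sat n b) O sat n a"
      using sat_dmult[OF dmult_closed[OF a b] a] sat_dmult[OF a b] eq by simp
    then obtain V' U' where "(U, V') \<in> sat n a" "(V', U') \<in> sat n b" "(U', V) \<in> sat n a"
      using UV(2) by blast
    then show "VU \<in> sat n b"
      using sat_functional[OF a] UV by metis
  qed
  have "sat n y = (sat n ?x)\<inverse>"
    using inv[OF x, of y] inv[of y, OF _ x] y by fast
  also have "\<dots> = sat n (J n m q p)"
    by (rule sat_J_converse[OF p q, symmetric])
  finally show "y = J n m q p" using y sat_inj J_closed[OF q p] by blast
qed

text \<open>An idempotent injective partial map is the identity on its domain; on the fibres of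
  single labels this makes the two labellings equal.\<close>

lemma idem_J:
  assumes e: "idem n e" and r: "drank e = m"
  obtains p where "onto n m p" "e = J n m p p"
proof -
  have ed: "e \<in> dsim n" and ee: "dmult n e e = e" using e by (auto simp: idem_def)
  obtain p q where pq: "onto n m p" "onto n m q" "e = J n m p q"
    using dsim_J[OF ed] r by metis
  have "U = V" if "(U, V) \<in> sat n e" for U V
  proof -
    have "(U, V) \<in> sat n e O sat n e" using that sat_dmult[OF ed ed] ee by simp
    then obtain W where "(U, W) \<in> sat n e" "(W, V) \<in> sat n e" by blast
    then show ?thesis using that sat_functional[OF ed] by metis
  qed
  then have eq: "fib n p T = fib n q T" if "T \<subseteq> {1..m}" for T
    using that unfolding pq(3) sat_J[OF pq(1,2)] by blast
  have "q s = p s" if s: "s \<in> {1..n}" for s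
  proof -
    have "s \<in> fib n p {p s}" using s by (simp add: fib_def)
    also have "fib n p {p s} = fib n q {p s}" using onto_mem[OF pq(1) s] by (intro eq) simp
    finally show ?thesis by (simp add: fib_def)
  qed
  then have "e = J n m p p" unfolding pq(3) by (intro J_cong) simp_all
  then show thesis using that pq(1) by blast
qed

lemma idem_J_diag: "onto n m p \<Longrightarrow> idem n (J n m p p)"
  by (simp add: idem_def J_closed J_mult)

section \<open>The relations F\<close>

text \<open>Changing the labelling by \<pi> conjugates the permutation by \<pi>; for members of a
  normal subgroup the choice of labelling therefore does not matter.\<close>

lemma J_shift:
  assumes \<pi>: "\<pi> permutes {1..m}" and \<tau>: "\<tau> permutes {1..m}" and p: "onto n m p"
    and eq: "\<forall>s\<in>{1..n}. p' s = \<pi> (p s)"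
  shows "J n m p' (\<tau> \<circ> p') = J n m p ((inv' \<pi> \<circ> \<tau> \<circ> \<pi>) \<circ> p)"
proof -
  have "J n m p' (\<tau> \<circ> p') = J n m (\<pi> \<circ> p) (\<tau> \<circ> (\<pi> \<circ> p))"
    using eq by (intro J_cong) simp_all
  also have "\<dots> = J n m p (inv' \<pi> \<circ> (\<tau> \<circ> (\<pi> \<circ> p)))"
    by (intro J_perm_left onto_perm_comp \<pi> \<tau> p)
  finally show ?thesis by (simp add: o_assoc)
qed

text \<open>The permutation acts on the second labelling because \<open>dmult\<close> composes from
  left to right and \<circ> from right to left; acting on the first labelling would give an
  anti-homomorphism.\<close>

definition hclass_map :: "nat \<Rightarrow> nat \<Rightarrow> (nat \<Rightarrow> nat) \<Rightarrow> (nat \<Rightarrow> nat) \<Rightarrow> dpart" where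
  "hclass_map n m p \<sigma> = J n m p (\<sigma> \<circ> p)"

lemma permutes_eqI:
  assumes "\<sigma> permutes A" "\<tau> permutes A" "\<And>i. i \<in> A \<Longrightarrow> \<sigma> i = \<tau> i"
  shows "\<sigma> = \<tau>"
proof
  show "\<sigma> i = \<tau> i" for i using assms by (cases "i \<in> A") (auto simp: permutes_not_in)
qed

lemma hclass_map_inj:
  assumes p: "onto n m p" and \<sigma>: "\<sigma> permutes {1..m}" and \<tau>: "\<tau> permutes {1..m}"
    and eq: "J n m p (\<sigma> \<circ> p) = J n m p (\<tau> \<circ> p)"
  shows "\<sigma> = \<tau>"
proof (rule permutes_eqI[OF \<sigma> \<tau>])
  fix i assume "i \<in> {1..m}"
  then obtain s where s: "s \<in> {1..n}" "p s = i" using onto_ex[OF p] by blast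
  show "\<sigma> i = \<tau> i"
    using J_eqD[OF p onto_perm_comp[OF \<sigma> p] onto_perm_comp[OF \<tau> p] eq s(1)] s(2) by simp
qed

lemma Hclass_J:
  assumes p: "onto n m p"
  shows "Hclass n (J n m p p) = hclass_map n m p ` carrier (sym_group m)"
proof (intro equalityI subsetI)
  fix x assume "x \<in> Hclass n (J n m p p)"
  then obtain \<sigma> where \<sigma>: "\<sigma> permutes {1..m}" "x = J n m (\<sigma> \<circ> p) p"
    by (auto simp: Hclass_def Hrel_J[OF p p])
  then have "x = hclass_map n m p (inv' \<sigma>)" by (simp add: hclass_map_def J_perm_left p)
  then show "x \<in> hclass_map n m p ` carrier (sym_group m)"
    using permutes_inv[OF \<sigma>(1)] unfolding sym_group_carrier[symmetric] by blast
next
  fix x assume "x \<in> hclass_map n m p ` carrier (sym_group m)"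
  then obtain \<sigma> where \<sigma>: "\<sigma> permutes {1..m}" "x = J n m p (\<sigma> \<circ> p)"
    by (auto simp: sym_group_carrier hclass_map_def)
  then have "x = J n m (inv' \<sigma> \<circ> p) p" by (simp add: J_perm_right p)
  then show "x \<in> Hclass n (J n m p p)"
    using permutes_inv[OF \<sigma>(1)] by (auto simp: Hclass_def Hrel_J[OF p p])
qed

lemma hclass_map_iso:
  assumes p: "onto n m p"
  shows "hclass_map n m p \<in> iso (sym_group m) (Hgroup n (J n m p p))"
proof (rule isoI)
  show "bij_betw (hclass_map n m p) (carrier (sym_group m)) (carrier (Hgroup n (J n m p p)))"
    unfolding bij_betw_def
    using hclass_map_inj[OF p] by (auto simp: Hgroup_def Hclass_J[OF p] hclass_map_def sym_group_carrier intro!: inj_onI)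
  show "hclass_map n m p \<in> hom (sym_group m) (Hgroup n (J n m p p))"
  proof (rule homI)
    fix \<sigma> \<tau> assume "\<sigma> \<in> carrier (sym_group m)" "\<tau> \<in> carrier (sym_group m)"
    then have \<sigma>: "\<sigma> permutes {1..m}" and \<tau>: "\<tau> permutes {1..m}" by (simp_all add: sym_group_carrier)
    \<comment> \<open>Relabelling the second factor by \<sigma> makes the middle labellings equal,
      so that \<open>J_mult\<close> applies.\<close>
    have "dmult n (hclass_map n m p \<sigma>) (hclass_map n m p \<tau>) =
        dmult n (J n m p (\<sigma> \<circ> p)) (J n m (\<sigma> \<circ> p) (\<sigma> \<circ> (\<tau> \<circ> p)))"
      unfolding hclass_map_def J_perm[OF \<sigma> p onto_perm_comp[OF \<tau> p]] ..
    also have "\<dots> = J n m p (\<sigma> \<circ> (\<tau> \<circ> p))"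
      using p \<sigma> \<tau> by (intro J_mult onto_perm_comp)
    also have "\<dots> = hclass_map n m p (\<sigma> \<circ> \<tau>)" by (simp add: hclass_map_def o_assoc)
    finally show "hclass_map n m p (\<sigma> \<otimes>\<^bsub>sym_group m\<^esub> \<tau>) =
        hclass_map n m p \<sigma> \<otimes>\<^bsub>Hgroup n (J n m p p)\<^esub> hclass_map n m p \<tau>"
      by (simp add: sym_group_mult Hgroup_def)
  qed (auto simp: Hgroup_def Hclass_J[OF p])
qed

lemma Hgroup_group:
  assumes p: "onto n m p"
  shows "group (Hgroup n (J n m p p))"
proof -
  have "hclass_map n m p \<one>\<^bsub>sym_group m\<^esub> = J n m p p" by (simp add: sym_group_one hclass_map_def)
  then have "(Hgroup n (J n m p p)) \<lparr>carrier := hclass_map n m p ` carrier (sym_group m),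
      one := hclass_map n m p \<one>\<^bsub>sym_group m\<^esub>\<rparr> = Hgroup n (J n m p p)"
    by (simp add: Hgroup_def Hclass_J[OF p])
  then show ?thesis
    using group.hom_imp_img_group[OF sym_group_is_group iso_imp_homomorphism[OF hclass_map_iso[OF p]]] by simp
qed

lemma iso_restrict:
  assumes "h \<in> iso G H" "N \<subseteq> carrier G"
  shows "h \<in> iso (G\<lparr>carrier := N\<rparr>) (H\<lparr>carrier := h ` N\<rparr>)"
  using assms by (auto simp: iso_def hom_def bij_betw_def inj_on_subset Pi_iff subset_iff)

text \<open>The image of A satisfies the description. Any other candidate, pulled back along the
  inverse isomorphism, is a normal subgroup of the symmetric group isomorphic to A, hence equal to A
  by \<open>sym_group_normal_iso_eq\<close>.\<close>

lemma A_at_J: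
  assumes p: "onto n m p" and A: "A \<lhd> sym_group m"
  shows "A_at n m A (J n m p p) = hclass_map n m p ` A"
  unfolding A_at_def
proof (rule the_equality)
  let ?G = "sym_group m" and ?H = "Hgroup n (J n m p p)" and ?f = "hclass_map n m p"
  note G = sym_group_is_group[of m] and H = Hgroup_group[OF p] and f = hclass_map_iso[OF p]
  have Asub: "A \<subseteq> carrier ?G" by (rule subgroup.subset[OF normal_imp_subgroup[OF A]])
  have AG: "group (?G\<lparr>carrier := A\<rparr>)"
    by (rule subgroup.subgroup_is_group[OF normal_imp_subgroup[OF A] G])
  show "?f ` A \<lhd> ?H \<and> ?H\<lparr>carrier := ?f ` A\<rparr> \<cong> ?G\<lparr>carrier := A\<rparr>"
    using iso_normal_subgroup[OF f G H A] group.iso_sym[OF AG is_isoI[OF iso_restrict[OF f Asub]]] by blast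
  fix N assume N: "N \<lhd> ?H \<and> ?H\<lparr>carrier := N\<rparr> \<cong> ?G\<lparr>carrier := A\<rparr>"
  let ?g = "inv_into (carrier ?G) ?f"
  have g: "?g \<in> iso ?H ?G" by (rule group.iso_set_sym[OF G f])
  have Nsub: "N \<subseteq> carrier ?H" using N subgroup.subset normal_imp_subgroup by blast
  have B: "?g ` N \<lhd> ?G" using iso_normal_subgroup[OF g H G] N by blast
  have NG: "group (?H\<lparr>carrier := N\<rparr>)"
    using subgroup.subgroup_is_group[OF normal_imp_subgroup H] N by blast
  have "?G\<lparr>carrier := ?g ` N\<rparr> \<cong> ?G\<lparr>carrier := A\<rparr>"
    using group.iso_sym[OF NG is_isoI[OF iso_restrict[OF g Nsub]]] N iso_trans by blast
  then have "?g ` N = A" by (rule sym_group_normal_iso_eq[OF B A])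
  then have "?f ` A = ?f ` ?g ` N" by simp
  also have "\<dots> = N"
  proof -
    have "?f ` carrier ?G = carrier ?H" using f by (simp add: iso_iff)
    then show ?thesis using Nsub by (intro image_inv_into_cancel)
  qed
  finally show "N = ?f ` A" ..
qed

lemma Nset_J:
  assumes A: "A \<lhd> sym_group m"
  shows "x \<in> Nset n m A \<longleftrightarrow> (\<exists>p \<sigma>. onto n m p \<and> \<sigma> \<in> A \<and> x = J n m p (\<sigma> \<circ> p))"
proof
  assume "x \<in> Nset n m A"
  then obtain e where e: "x \<in> A_at n m A e" "idem n e" "drank e = m"
    by (auto simp: Nset_def)
  obtain p where p: "onto n m p" "e = J n m p p" by (rule idem_J[OF e(2,3)])
  then show "\<exists>p \<sigma>. onto n m p \<and> \<sigma> \<in> A \<and> x = J n m p (\<sigma> \<circ> p)"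
    using e(1) A_at_J[OF p(1) A] by (auto simp: hclass_map_def)
next
  assume "\<exists>p \<sigma>. onto n m p \<and> \<sigma> \<in> A \<and> x = J n m p (\<sigma> \<circ> p)"
  then obtain p \<sigma> where p: "onto n m p" and "\<sigma> \<in> A" "x = J n m p (\<sigma> \<circ> p)" by blast
  then have "x \<in> A_at n m A (J n m p p)" unfolding A_at_J[OF p A] by (auto simp: hclass_map_def)
  moreover have "idem n (J n m p p)" "drank (J n m p p) = m" using idem_J_diag J_rank p by blast+
  ultimately show "x \<in> Nset n m A" unfolding Nset_def by blast
qed

lemma Frel_J:
  assumes A: "A \<lhd> sym_group (k + 1)"
  shows "(x, y) \<in> Frel n k A \<longleftrightarrow> (\<exists>p q \<sigma>. onto n (k + 1) p \<and> onto n (k + 1) q \<and> \<sigma> \<in> A \<and>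
    x = J n (k + 1) p q \<and> y = J n (k + 1) (\<sigma> \<circ> p) q)"
proof
  let ?m = "k + 1"
  note A' = A[unfolded sym_normal_iff]
  assume xy: "(x, y) \<in> Frel n k A"
  then have xd: "x \<in> dsim n" "drank x = ?m" and "Hrel n x y" and N: "dmult n x (dinv n y) \<in> Nset n ?m A"
    by (auto simp: Frel_def Dcl_def)
  obtain p q where p: "onto n ?m p" and q: "onto n ?m q" and x: "x = J n ?m p q"
    using dsim_J[OF xd(1)] xd(2) by metis
  have "Hrel n y x" using \<open>Hrel n x y\<close> unfolding Hrel_def by blast
  then obtain \<sigma> where \<sigma>: "\<sigma> permutes {1..?m}" and y: "y = J n ?m (\<sigma> \<circ> p) q"
    unfolding x Hrel_J[OF p q] by blast
  note sp = onto_perm_comp[OF \<sigma> p]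
  have "dmult n x (dinv n y) = J n ?m p (\<sigma> \<circ> p)"
    unfolding x y dinv_J[OF sp q] by (rule J_mult[OF p q sp])
  \<comment> \<open>Membership in \<open>Nset\<close> may be witnessed with another labelling p'.
    Equal domains make p' a relabelling of p by some \<pi>, so \<sigma> is a conjugate of \<tau> and
    lies in A by normality.\<close>
  then obtain p' \<tau> where p': "onto n ?m p'" "\<tau> \<in> A" and eq: "J n ?m p (\<sigma> \<circ> p) = J n ?m p' (\<tau> \<circ> p')"
    using N unfolding Nset_J[OF A] by metis
  have \<tau>: "\<tau> permutes {1..?m}" using p'(2) A' by blast
  have "fib n p' ` Pow {1..?m} \<subseteq> fib n p ` Pow {1..?m}"
    using Domain_sat_J[OF p sp] Domain_sat_J[OF p'(1) onto_perm_comp[OF \<tau> p'(1)]] eq by simp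
  then obtain \<pi> where \<pi>: "\<pi> permutes {1..?m}" "\<forall>s\<in>{1..n}. p' s = \<pi> (p s)"
    using fib_factor_perm[OF p p'(1)] by blast
  have "J n ?m p (\<sigma> \<circ> p) = J n ?m p ((inv' \<pi> \<circ> \<tau> \<circ> \<pi>) \<circ> p)"
    unfolding eq by (rule J_shift[OF \<pi>(1) \<tau> p \<pi>(2)])
  moreover have "inv' \<pi> \<circ> \<tau> \<circ> \<pi> permutes {1..?m}"
    by (intro permutes_compose permutes_inv \<pi> \<tau>)
  ultimately have "\<sigma> = inv' \<pi> \<circ> \<tau> \<circ> \<pi>" using hclass_map_inj[OF p \<sigma>] by blast
  moreover have "inv' \<pi> \<circ> \<tau> \<circ> inv' (inv' \<pi>) \<in> A"
    using A' p'(2) permutes_inv[OF \<pi>(1)] by blast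
  ultimately have "\<sigma> \<in> A" by (simp add: permutes_inv_inv[OF \<pi>(1)])
  then show "\<exists>p q \<sigma>. onto n ?m p \<and> onto n ?m q \<and> \<sigma> \<in> A \<and> x = J n ?m p q \<and> y = J n ?m (\<sigma> \<circ> p) q"
    using p q x y by blast
next
  let ?m = "k + 1"
  assume "\<exists>p q \<sigma>. onto n ?m p \<and> onto n ?m q \<and> \<sigma> \<in> A \<and> x = J n ?m p q \<and> y = J n ?m (\<sigma> \<circ> p) q"
  then obtain p q \<sigma> where p: "onto n ?m p" and q: "onto n ?m q" and "\<sigma> \<in> A"
    and x: "x = J n ?m p q" and y: "y = J n ?m (\<sigma> \<circ> p) q" by blast
  have \<sigma>: "\<sigma> permutes {1..?m}" using A \<open>\<sigma> \<in> A\<close> unfolding sym_normal_iff by blast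
  note sp = onto_perm_comp[OF \<sigma> p]
  have "Hrel n y x" unfolding x Hrel_J[OF p q] using \<sigma> y by blast
  then have "Hrel n x y" unfolding Hrel_def by blast
  moreover have "dmult n x (dinv n y) = J n ?m p (\<sigma> \<circ> p)"
    unfolding x y dinv_J[OF sp q] by (rule J_mult[OF p q sp])
  then have "dmult n x (dinv n y) \<in> Nset n ?m A"
    unfolding Nset_J[OF A] using p \<open>\<sigma> \<in> A\<close> by blast
  ultimately show "(x, y) \<in> Frel n k A"
    using p q sp J_closed J_rank x y by (auto simp: Frel_def Dcl_def)
qed

section \<open>Congruences\<close>

lemma rho_equiv:
  assumes A: "A \<lhd> sym_group (k + 1)"
  shows "equiv (dsim n) (rho n k A)"
proof (rule equivI)
  let ?m = "k + 1"
  note A' = A[unfolded sym_normal_iff]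
  have perm: "\<sigma> permutes {1..?m}" if "\<sigma> \<in> A" for \<sigma> using that A' by blast
  show "rho n k A \<subseteq> dsim n \<times> dsim n"
    by (auto simp: rho_def Frel_def Dcl_def Ideal_k_def)
  show "refl_on (dsim n) (rho n k A)" by (auto simp: refl_on_def rho_def)
  have Fsym: "(y, x) \<in> Frel n k A" if xy: "(x, y) \<in> Frel n k A" for x y
  proof -
    obtain p q \<sigma> where pq: "onto n ?m p" "onto n ?m q" "\<sigma> \<in> A" "x = J n ?m p q" "y = J n ?m (\<sigma> \<circ> p) q"
      using xy unfolding Frel_J[OF A] by blast
    have "inv' \<sigma> \<circ> (\<sigma> \<circ> p) = p" by (simp add: o_assoc permutes_inv_o(2)[OF perm[OF pq(3)]])
    then have "x = J n ?m (inv' \<sigma> \<circ> (\<sigma> \<circ> p)) q" using pq(4) by simp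
    moreover have "inv' \<sigma> \<in> A" using A' pq(3) by blast
    ultimately show ?thesis
      unfolding Frel_J[OF A] using pq onto_perm_comp[OF perm[OF pq(3)] pq(1)] by blast
  qed
  then show "sym (rho n k A)" by (auto simp: sym_def rho_def)
  have Ftrans: "(x, z) \<in> Frel n k A" if xy: "(x, y) \<in> Frel n k A" and yz: "(y, z) \<in> Frel n k A" for x y z
  proof -
    obtain p q \<sigma> where pq: "onto n ?m p" "onto n ?m q" "\<sigma> \<in> A" "x = J n ?m p q" "y = J n ?m (\<sigma> \<circ> p) q"
      using xy unfolding Frel_J[OF A] by blast
    obtain p' q' \<tau> where pq': "onto n ?m p'" "onto n ?m q'" "\<tau> \<in> A" "y = J n ?m p' q'" "z = J n ?m (\<tau> \<circ> p') q'"
      using yz unfolding Frel_J[OF A] by blast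
    note sp = onto_perm_comp[OF perm[OF pq(3)] pq(1)]
    \<comment> \<open>The element y now has two descriptions. They differ by a relabelling \<pi>,
      and rewriting z in the labellings of x replaces \<tau> by its conjugate under
      \<open>inv' \<pi>\<close>.\<close>
    have "fib n p' ` Pow {1..?m} \<subseteq> fib n (\<sigma> \<circ> p) ` Pow {1..?m}"
      using Domain_sat_J[OF sp pq(2)] Domain_sat_J[OF pq'(1,2)] pq(5) pq'(4) by simp
    then obtain \<pi> where \<pi>: "\<pi> permutes {1..?m}" "\<forall>s\<in>{1..n}. p' s = \<pi> ((\<sigma> \<circ> p) s)"
      using fib_factor_perm[OF sp pq'(1)] by blast
    have "J n ?m p' q' = J n ?m (\<pi> \<circ> (\<sigma> \<circ> p)) q'" using \<pi>(2) by (intro J_cong) simp_all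
    also have "\<dots> = J n ?m (\<sigma> \<circ> p) (inv' \<pi> \<circ> q')" by (rule J_perm_left[OF \<pi>(1) sp pq'(2)])
    finally have eq: "J n ?m (\<sigma> \<circ> p) q = J n ?m (\<sigma> \<circ> p) (inv' \<pi> \<circ> q')"
      using pq(5) pq'(4) by simp
    note iq = onto_perm_comp[OF permutes_inv[OF \<pi>(1)] pq'(2)]
    have q: "q s = (inv' \<pi> \<circ> q') s" if "s \<in> {1..n}" for s
      by (rule J_eqD[OF sp pq(2) iq eq that])
    have "z = J n ?m (\<tau> \<circ> (\<pi> \<circ> (\<sigma> \<circ> p))) q'" unfolding pq'(5) using \<pi>(2) by (intro J_cong) simp_all
    also have "\<dots> = J n ?m (\<pi> \<circ> (inv' \<pi> \<circ> \<tau> \<circ> \<pi> \<circ> \<sigma> \<circ> p)) q'"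
      by (simp add: o_assoc permutes_inv_o(1)[OF \<pi>(1)])
    also have "\<dots> = J n ?m (inv' \<pi> \<circ> \<tau> \<circ> \<pi> \<circ> \<sigma> \<circ> p) (inv' \<pi> \<circ> q')"
      by (intro J_perm_left onto_perm_comp[of _ ?m n p] permutes_compose permutes_inv \<pi> perm pq pq')
    also have "\<dots> = J n ?m ((inv' \<pi> \<circ> \<tau> \<circ> inv' (inv' \<pi>) \<circ> \<sigma>) \<circ> p) q"
      using q by (intro J_cong) (simp_all add: permutes_inv_inv[OF \<pi>(1)])
    finally have z: "z = J n ?m ((inv' \<pi> \<circ> \<tau> \<circ> inv' (inv' \<pi>) \<circ> \<sigma>) \<circ> p) q" .
    have "inv' \<pi> \<circ> \<tau> \<circ> inv' (inv' \<pi>) \<in> A" using A' pq'(3) permutes_inv[OF \<pi>(1)] by blast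
    then have "inv' \<pi> \<circ> \<tau> \<circ> inv' (inv' \<pi>) \<circ> \<sigma> \<in> A" using A' pq(3) by blast
    then show ?thesis unfolding Frel_J[OF A] using pq z by blast
  qed
  \<comment> \<open>Pairs of \<open>Frel\<close> cannot be chained with pairs of the ideal: the
    former live in rank k + 1, the latter in rank at most k.\<close>
  have FI: "drank x = ?m \<and> drank y = ?m" if "(x, y) \<in> Frel n k A" for x y
    using that by (simp add: Frel_def Dcl_def)
  show "trans (rho n k A)"
  proof (rule transI)
    fix x y z assume xy: "(x, y) \<in> rho n k A" and yz: "(y, z) \<in> rho n k A"
    have split: "u = v \<or> (u, v) \<in> Frel n k A \<or> u \<in> Ideal_k n k \<and> v \<in> Ideal_k n k"
      if "(u, v) \<in> rho n k A" for u v
      using that by (auto simp: rho_def)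
    have disj: "(u, v) \<in> Frel n k A \<Longrightarrow> u \<notin> Ideal_k n k \<and> v \<notin> Ideal_k n k" for u v
      using FI[of u v] by (simp add: Ideal_k_def)
    consider "x = y" | "y = z" | "(x, y) \<in> Frel n k A" "(y, z) \<in> Frel n k A"
      | "x \<in> Ideal_k n k" "z \<in> Ideal_k n k"
      using split[OF xy] split[OF yz] disj by blast
    then show "(x, z) \<in> rho n k A"
      by cases (use xy yz Ftrans in \<open>auto simp: rho_def\<close>)
  qed
qed

lemma rho_mult:
  assumes A: "A \<lhd> sym_group (k + 1)" and ab: "(a, b) \<in> rho n k A" and c: "c \<in> dsim n"
  shows "(dmult n a c, dmult n b c) \<in> rho n k A" "(dmult n c a, dmult n c b) \<in> rho n k A"
proof -
  let ?m = "k + 1"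
  note A' = A[unfolded sym_normal_iff]
  consider "a = b" "a \<in> dsim n" | "a \<in> Ideal_k n k" "b \<in> Ideal_k n k" | "(a, b) \<in> Frel n k A"
    using ab by (auto simp: rho_def)
  then have "(dmult n a c, dmult n b c) \<in> rho n k A \<and> (dmult n c a, dmult n c b) \<in> rho n k A"
  proof cases
    case 1
    then show ?thesis using dmult_closed c by (auto simp: rho_def)
  next
    case 2
    then have ab: "a \<in> dsim n" "b \<in> dsim n" "drank a \<le> k" "drank b \<le> k" by (auto simp: Ideal_k_def)
    show ?thesis
      using drank_mult_le(1)[OF ab(1) c] drank_mult_le(1)[OF ab(2) c]
        drank_mult_le(2)[OF c ab(1)] drank_mult_le(2)[OF c ab(2)] ab
      by (simp add: rho_def Ideal_k_def dmult_closed c)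
  next
    case 3
    then obtain p q \<sigma> where pq: "onto n ?m p" "onto n ?m q" "\<sigma> \<in> A" "a = J n ?m p q" "b = J n ?m (\<sigma> \<circ> p) q"
      unfolding Frel_J[OF A] by blast
    have \<sigma>: "\<sigma> permutes {1..?m}" using A' pq(3) by blast
    note sp = onto_perm_comp[OF \<sigma> pq(1)] and sq = onto_perm_comp[OF permutes_inv[OF \<sigma>] pq(2)]
    have a: "a \<in> dsim n" and b: "b \<in> dsim n" using pq sp J_closed by auto
    have u: "J n ?m (\<sigma> \<circ> p) p \<in> dsim n" and v: "J n ?m q (inv' \<sigma> \<circ> q) \<in> dsim n"
      using J_closed pq sp sq by auto
    \<comment> \<open>Since b is a left and a right multiple of a, the product
      \<open>dmult n b c\<close> is a left multiple of \<open>dmult n a c\<close>, and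
      \<open>dmult n c b\<close> a right multiple of \<open>dmult n c a\<close>. So if the product
      with a drops into the ideal, the one with b does too; if not, the permutation survives
      unchanged.\<close>
    have b1: "b = dmult n (J n ?m (\<sigma> \<circ> p) p) a"
      unfolding pq(4,5) using J_mult[OF sp pq(1,2)] by simp
    have b2: "b = dmult n a (J n ?m q (inv' \<sigma> \<circ> q))"
      unfolding pq(4,5) using J_mult[OF pq(1,2) sq] J_perm_left[OF \<sigma> pq(1,2)] by simp
    have bc: "dmult n b c = dmult n (J n ?m (\<sigma> \<circ> p) p) (dmult n a c)"
      unfolding b1 by (rule dmult_assoc[OF u a c])
    have cb: "dmult n c b = dmult n (dmult n c a) (J n ?m q (inv' \<sigma> \<circ> q))"
      unfolding b2 by (rule dmult_assoc[OF c a v, symmetric])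
    have "(dmult n a c, dmult n b c) \<in> rho n k A"
    proof (cases "drank (dmult n a c) = ?m")
      case True
      then obtain r where r: "onto n ?m r" "dmult n a c = J n ?m p r"
        using drank_mult_left_eq[OF pq(1,2) c] pq(4) by metis
      have "dmult n b c = J n ?m (\<sigma> \<circ> p) r"
        unfolding bc r(2) by (rule J_mult[OF sp pq(1) r(1)])
      then have "(dmult n a c, dmult n b c) \<in> Frel n k A"
        unfolding Frel_J[OF A] using r pq by blast
      then show ?thesis by (simp add: rho_def)
    next
      case False
      then have "drank (dmult n a c) \<le> k"
        using drank_mult_le(1)[OF a c] J_rank[OF pq(1,2)] pq(4) by simp
      then show ?thesis
        using drank_mult_le(2)[OF u dmult_closed[OF a c]] dmult_closed[OF a c] dmult_closed[OF b c] bc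
        by (simp add: rho_def Ideal_k_def)
    qed
    moreover have "(dmult n c a, dmult n c b) \<in> rho n k A"
    proof (cases "drank (dmult n c a) = ?m")
      case True
      then obtain r where r: "onto n ?m r" "dmult n c a = J n ?m r q"
        using drank_mult_right_eq[OF pq(1,2) c] pq(4) by metis
      have "dmult n c b = J n ?m r (inv' \<sigma> \<circ> q)"
        unfolding cb r(2) by (rule J_mult[OF r(1) pq(2) sq])
      also have "\<dots> = J n ?m (\<sigma> \<circ> r) q" by (rule J_perm_left[OF \<sigma> r(1) pq(2), symmetric])
      finally have "(dmult n c a, dmult n c b) \<in> Frel n k A"
        unfolding Frel_J[OF A] using r pq by blast
      then show ?thesis by (simp add: rho_def)
    next
      case False
      then have "drank (dmult n c a) \<le> k"
        using drank_mult_le(2)[OF c a] J_rank[OF pq(1,2)] pq(4) by simp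
      then show ?thesis
        using drank_mult_le(1)[OF dmult_closed[OF c a] v] dmult_closed[OF c a] dmult_closed[OF c b] cb
        by (simp add: rho_def Ideal_k_def)
    qed
    ultimately show ?thesis ..
  qed
  then show "(dmult n a c, dmult n b c) \<in> rho n k A" "(dmult n c a, dmult n c b) \<in> rho n k A" by simp_all
qed

lemma rho_congruence: "A \<lhd> sym_group (k + 1) \<Longrightarrow> dcongruence n (rho n k A)"
  unfolding dcongruence_def using rho_equiv rho_mult by blast

section \<open>The zero element, for n at least 1 the partition with a single block, and the merging
  of two labels\<close>

definition dzero :: "nat \<Rightarrow> dpart" where
  "dzero n = J n 1 (\<lambda>_. 1) (\<lambda>_. 1)"

lemma onto_1: "onto n 1 p \<Longrightarrow> s \<in> {1..n} \<Longrightarrow> p s = 1"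
  using onto_mem[of n 1 p s] by simp

lemma J_1: "\<lbrakk>onto n 1 p; onto n 1 q\<rbrakk> \<Longrightarrow> J n 1 p q = dzero n"
  unfolding dzero_def using onto_1 by (intro J_cong) blast+

lemma onto_pos: "\<lbrakk>1 \<le> n; onto n m p\<rbrakk> \<Longrightarrow> 1 \<le> m"
  using onto_mem[of n m p 1] by simp

lemma dzero_closed: "1 \<le> n \<Longrightarrow> dzero n \<in> dsim n" and drank_dzero: "1 \<le> n \<Longrightarrow> drank (dzero n) = 1"
proof -
  assume "1 \<le> n"
  then have "onto n 1 (\<lambda>_. 1)" by (auto simp: onto_def image_constant_conv)
  then show "dzero n \<in> dsim n" "drank (dzero n) = 1"
    unfolding dzero_def using J_closed J_rank by blast+
qed

lemma drank_bounds:
  assumes "1 \<le> n" "a \<in> dsim n"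
  shows "1 \<le> drank a" "drank a \<le> n"
  using dsim_J[OF assms(2)] onto_pos[OF assms(1)] onto_le by metis+

lemma drank_1_dzero:
  assumes "1 \<le> n" "a \<in> dsim n" "drank a \<le> 1"
  shows "a = dzero n"
proof -
  have "drank a = 1" using drank_bounds[OF assms(1,2)] assms(3) by simp
  then show ?thesis using dsim_J[OF assms(2)] J_1 by metis
qed

lemma dmult_dzero:
  assumes "1 \<le> n" "a \<in> dsim n"
  shows "dmult n a (dzero n) = dzero n" "dmult n (dzero n) a = dzero n"
  using drank_mult_le(2)[OF assms(2) dzero_closed[OF assms(1)]]
    drank_mult_le(1)[OF dzero_closed[OF assms(1)] assms(2)]
    drank_1_dzero[OF assms(1)] dmult_closed assms dzero_closed[OF assms(1)] drank_dzero[OF assms(1)]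
  by metis+

text \<open>Number all labels except j bijectively and give j the number of i. The last property,
  that nothing else is identified, is what \<open>rel_top\<close> needs.\<close>

lemma ex_merge:
  fixes m :: nat
  assumes ij: "i \<in> {1..m}" "j \<in> {1..m}" "i \<noteq> j"
  obtains h where "onto m (m - 1) h" "h i = h j"
    "\<And>a b. \<lbrakk>a \<in> {1..m}; b \<in> {1..m}; h a = h b; a \<noteq> b\<rbrakk> \<Longrightarrow> a \<in> {i, j} \<and> b \<in> {i, j}"
proof -
  have "card ({1..m} - {j}) = card {1..m - 1}" using ij(2) by simp
  then obtain g where g: "bij_betw g ({1..m} - {j}) {1..m - 1}"
    by (metis finite_Diff finite_atLeastAtMost finite_same_card_bij)
  have i: "i \<in> {1..m} - {j}" using ij by blast
  define h where "h = g(j := g i)"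
  have "h ` {1..m} = h ` insert j ({1..m} - {j})" using ij(2) by (simp add: insert_absorb)
  also have "\<dots> = insert (g i) (g ` ({1..m} - {j}))" by (auto simp: h_def)
  also have "\<dots> = {1..m - 1}" using g i by (auto simp: bij_betw_def)
  finally have "onto m (m - 1) h" by (simp add: onto_def)
  moreover have "h i = h j" using ij(3) by (simp add: h_def)
  moreover have "a \<in> {i, j} \<and> b \<in> {i, j}"
    if ab: "a \<in> {1..m}" "b \<in> {1..m}" "h a = h b" "a \<noteq> b" for a b
  proof -
    have inj: "x = y" if "x \<in> {1..m} - {j}" "y \<in> {1..m} - {j}" "g x = g y" for x y
      using g that by (metis bij_betw_imp_inj_on inj_onD)
    show ?thesis
    proof (cases "a = j \<or> b = j")
      case True
      then show ?thesis using inj[OF i, of b] inj[OF i, of a] ab by (auto simp: h_def)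
    next
      case False
      then show ?thesis using inj[of a b] ab by (simp add: h_def)
    qed
  qed
  ultimately show thesis using that by blast
qed

section \<open>Classification of an arbitrary congruence\<close>

locale dcong =
  fixes n :: nat and \<rho> :: "(dpart \<times> dpart) set"
  assumes n: "1 \<le> n" and cong: "dcongruence n \<rho>"
begin

lemma rcl: "(a, b) \<in> \<rho> \<Longrightarrow> a \<in> dsim n" "(a, b) \<in> \<rho> \<Longrightarrow> b \<in> dsim n"
  and rrefl: "a \<in> dsim n \<Longrightarrow> (a, a) \<in> \<rho>"
  and rsym: "(a, b) \<in> \<rho> \<Longrightarrow> (b, a) \<in> \<rho>"
  and rtrans: "(a, b) \<in> \<rho> \<Longrightarrow> (b, c) \<in> \<rho> \<Longrightarrow> (a, c) \<in> \<rho>"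
  and rright: "(a, b) \<in> \<rho> \<Longrightarrow> c \<in> dsim n \<Longrightarrow> (dmult n a c, dmult n b c) \<in> \<rho>"
  and rleft: "(a, b) \<in> \<rho> \<Longrightarrow> c \<in> dsim n \<Longrightarrow> (dmult n c a, dmult n c b) \<in> \<rho>"
  using cong unfolding dcongruence_def equiv_def refl_on_def by (auto dest: symD transD)

lemma rmult:
  assumes "(a, b) \<in> \<rho>" "(c, d) \<in> \<rho>"
  shows "(dmult n a c, dmult n b d) \<in> \<rho>"
  using rtrans[OF rright[OF assms(1) rcl(1)[OF assms(2)]] rleft[OF assms(2) rcl(2)[OF assms(1)]]] .

definition Zcl :: "dpart set" where
  "Zcl = {a. (a, dzero n) \<in> \<rho>}"

lemma Zcl_sub: "a \<in> Zcl \<Longrightarrow> a \<in> dsim n"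
  unfolding Zcl_def using rcl by blast

lemma Zcl_mult:
  assumes a: "a \<in> Zcl" and b: "b \<in> dsim n"
  shows "dmult n a b \<in> Zcl" "dmult n b a \<in> Zcl"
  using rright[of a "dzero n" b] rleft[of a "dzero n" b] a b dmult_dzero[OF n b] by (auto simp: Zcl_def)

definition zrank :: nat where
  "zrank = Max (drank ` Zcl)"

lemma Zcl_finite: "finite (drank ` Zcl)"
  by (rule finite_subset[of _ "{1..n}"]) (use drank_bounds[OF n] Zcl_sub in auto)

lemma dzero_Zcl: "dzero n \<in> Zcl"
  unfolding Zcl_def using rrefl dzero_closed[OF n] by blast

lemma zrank_bounds: "1 \<le> zrank" "zrank \<le> n"
proof -
  have "drank (dzero n) \<le> zrank"
    unfolding zrank_def using dzero_Zcl Zcl_finite by (intro Max_ge) auto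
  then show "1 \<le> zrank" by (simp add: drank_dzero[OF n])
  have "zrank \<in> drank ` Zcl"
    unfolding zrank_def using dzero_Zcl Zcl_finite by (intro Max_in) auto
  then show "zrank \<le> n" using Zcl_sub drank_bounds[OF n] by auto
qed

text \<open>The class of zero is an ideal, and an element b of largest rank in it yields every a of
  at most that rank as a product x b y, where x and y collapse the surplus labels.\<close>

lemma Zcl_eq: "Zcl = Ideal_k n zrank"
proof (intro equalityI subsetI)
  fix a assume "a \<in> Zcl"
  then show "a \<in> Ideal_k n zrank"
    unfolding Ideal_k_def zrank_def using Zcl_sub Zcl_finite by (auto intro: Max_ge)
next
  fix a assume "a \<in> Ideal_k n zrank"
  then have a: "a \<in> dsim n" "drank a \<le> zrank" by (auto simp: Ideal_k_def)
  let ?j = "drank a" and ?k = zrank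
  have "zrank \<in> drank ` Zcl"
    unfolding zrank_def using dzero_Zcl Zcl_finite by (intro Max_in) auto
  then obtain b where b: "b \<in> Zcl" "drank b = ?k" by auto
  obtain p q where pq: "onto n ?k p" "onto n ?k q" "b = J n ?k p q"
    using dsim_J[OF Zcl_sub[OF b(1)]] b(2) by metis
  obtain p' q' where pq': "onto n ?j p'" "onto n ?j q'" "a = J n ?j p' q'"
    using dsim_J[OF a(1)] by metis
  \<comment> \<open>Capping at \<open>drank a\<close> collapses the labels of b to those of
    a.\<close>
  have h: "onto ?k ?j (min ?j)" using onto_min[OF drank_bounds(1)[OF n a(1)] a(2)] .
  note hp = onto_comp[OF h pq(1)] and hq = onto_comp[OF h pq(2)]
  have "dmult n (dmult n (J n ?j p' (min ?j \<circ> p)) b) (J n ?j (min ?j \<circ> q) q') = a"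
    unfolding pq(3) J_mult_right[OF pq'(1) pq(1,2) h] J_mult[OF pq'(1) hq pq'(2)] pq'(3)[symmetric] ..
  moreover have "dmult n (dmult n (J n ?j p' (min ?j \<circ> p)) b) (J n ?j (min ?j \<circ> q) q') \<in> Zcl"
    by (intro Zcl_mult b J_closed pq' hp hq)
  ultimately show "a \<in> Zcl" by simp
qed

lemma Zcl_rel: "(a, b) \<in> \<rho> \<Longrightarrow> a \<in> Zcl \<longleftrightarrow> b \<in> Zcl"
  unfolding Zcl_def using rtrans rsym by blast

text \<open>Let e be the idempotent \<open>J n m p p\<close> and g the idempotent with the same
  domain as d. Then g e = g and g d = d, so multiplying the pair (e, d) by g on the left relates g
  to d and hence to e.\<close>

lemma rel_idem:
  assumes p: "onto n m p" and d: "(J n m p p, d) \<in> \<rho>"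
    and le: "Domain (sat n d) \<subseteq> fib n p ` Pow {1..m}"
  shows "\<exists>h. onto m (drank d) h \<and> (J n m p p, J n (drank d) (h \<circ> p) (h \<circ> p)) \<in> \<rho>"
proof -
  let ?e = "J n m p p" and ?r = "drank d"
  have dd: "d \<in> dsim n" using rcl d by blast
  obtain f g where fg: "onto n ?r f" "onto n ?r g" "d = J n ?r f g"
    by (rule dsim_J[OF dd])
  have "Domain (sat n d) = fib n f ` Pow {1..?r}"
    using Domain_sat_J[OF fg(1,2)] fg(3) by simp
  then have "fib n f ` Pow {1..?r} \<subseteq> fib n p ` Pow {1..m}" using le by simp
  then obtain h where h: "onto m ?r h" "\<forall>s\<in>{1..n}. f s = h (p s)"
    using fib_factor[OF p fg(1)] by blast
  note hp = onto_comp[OF h(1) p]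
  have d': "d = J n ?r (h \<circ> p) g" using fg(3) h(2) J_cong[of n f "h \<circ> p" g g ?r] by simp
  let ?g = "J n ?r (h \<circ> p) (h \<circ> p)"
  have "(dmult n ?g ?e, dmult n ?g d) \<in> \<rho>" by (rule rleft[OF d J_closed[OF hp hp]])
  moreover have "dmult n ?g ?e = ?g" by (rule J_mult_right[OF hp p p h(1)])
  moreover have "dmult n ?g d = d"
    by (subst (1 2) d') (rule J_mult[OF hp hp fg(2)])
  ultimately have "(?e, ?g) \<in> \<rho>" using d rtrans rsym by metis
  then show ?thesis using h(1) by blast
qed

lemma rel_rank:
  assumes m: "zrank < m" and p: "onto n m p" and c: "(J n m p p, c) \<in> \<rho>"
  shows "drank (dmult n (J n m p p) c) = m"
proof (rule ccontr)
  let ?e = "J n m p p"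
  assume ne: "drank (dmult n ?e c) \<noteq> m"
  have e: "?e \<in> dsim n" by (rule J_closed[OF p p])
  have cd: "c \<in> dsim n" using c rcl by blast
  have dom: "Domain (sat n (dmult n ?e d)) \<subseteq> fib n p ` Pow {1..m}" if "d \<in> dsim n" for d
    using Domain_sat_J[OF p p] unfolding sat_dmult[OF e that] by blast
  \<comment> \<open>\<open>P r\<close> says that e is related to an idempotent of rank r below it;
    being below e means that its labelling factors through p.\<close>
  define P where "P r \<longleftrightarrow> (\<exists>h. onto m r h \<and> (?e, J n r (h \<circ> p) (h \<circ> p)) \<in> \<rho>)" for r
  have Pd: "P (drank (dmult n ?e d))" if "(?e, d) \<in> \<rho>" for d
  proof -
    have "(dmult n ?e ?e, dmult n ?e d) \<in> \<rho>" by (rule rleft[OF that e])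
    then have "(?e, dmult n ?e d) \<in> \<rho>" by (simp add: J_mult p)
    from rel_idem[OF p this dom[OF rcl(2)[OF that]]] show ?thesis unfolding P_def .
  qed
  define r where "r = (LEAST r. P r)"
  have Pr: "P r" unfolding r_def using Pd[OF c] by (rule LeastI)
  have min: "r \<le> r'" if "P r'" for r' unfolding r_def using that by (rule Least_le)
  have "r < m" using min[OF Pd[OF c]] ne drank_mult_le(1)[OF e cd] J_rank[OF p p] by simp
  obtain h where h: "onto m r h" and eh: "(?e, J n r (h \<circ> p) (h \<circ> p)) \<in> \<rho>"
    using Pr unfolding P_def by blast
  note hp = onto_comp[OF h p]
  let ?g = "J n r (h \<circ> p) (h \<circ> p)"
  have "r \<noteq> 0" using onto_pos[OF n hp] by simp
  \<comment> \<open>An idempotent of rank 1 is the zero, and e would lie in the zero class in spite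
    of its rank exceeding \<open>zrank\<close>.\<close>
  moreover have "r \<noteq> 1"
  proof
    assume "r = 1"
    then have "?g = dzero n" using J_1 hp by metis
    then have "?e \<in> Zcl" using eh by (simp add: Zcl_def)
    then show False using m J_rank[OF p p] by (simp add: Zcl_eq Ideal_k_def)
  qed
  ultimately have r2: "2 \<le> r" by simp
  \<comment> \<open>As r < m, some labels i and j are merged by h; as r is at least 2, some l has a
    different image. Swapping j and l yields a map that separates i from j.\<close>
  have "\<not> inj_on h {1..m}"
    using \<open>r < m\<close> h card_image[of h "{1..m}"] by (auto simp: onto_def)
  then obtain i j where ij: "i \<in> {1..m}" "j \<in> {1..m}" "i \<noteq> j" "h i = h j"
    unfolding inj_on_def by blast
  have "\<exists>x\<in>{1..r}. x \<noteq> h i" using r2 by (intro bexI[of _ "if h i = 1 then 2 else 1"]) auto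
  then obtain l where l: "l \<in> {1..m}" "h l \<noteq> h i" using onto_ex[OF h] by metis
  define t where "t = transpose j l"
  have t: "t permutes {1..m}" unfolding t_def using ij l by (intro permutes_swap_id)
  have ht: "onto m r (h \<circ> t)" by (rule onto_comp[OF h onto_permutes[OF t]])
  note tp = onto_perm_comp[OF t p] and htp = onto_comp[OF ht p]
  have htp': "(h \<circ> t) \<circ> p = h \<circ> (t \<circ> p)" by (simp add: o_assoc)
  let ?g' = "J n r ((h \<circ> t) \<circ> p) ((h \<circ> t) \<circ> p)"
  \<comment> \<open>Conjugation by an element of the group \<open>Hclass n ?e\<close> fixes e and
    replaces h by h \<circ> t in the related idempotent.\<close>
  have "(dmult n (dmult n (J n m (t \<circ> p) p) ?e) (J n m p (t \<circ> p)),
         dmult n (dmult n (J n m (t \<circ> p) p) ?g) (J n m p (t \<circ> p))) \<in> \<rho>"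
    by (intro rright rleft eh J_closed p tp)
  moreover have "dmult n (dmult n (J n m (t \<circ> p) p) ?e) (J n m p (t \<circ> p)) = ?e"
    by (simp add: J_mult p tp J_perm[OF t p p])
  moreover have "dmult n (dmult n (J n m (t \<circ> p) p) ?g) (J n m p (t \<circ> p)) = ?g'"
    unfolding htp' J_mult_left[OF tp p hp h] using J_mult_right[OF _ p tp h] onto_comp[OF h tp] by simp
  ultimately have eg': "(?e, ?g') \<in> \<rho>" by simp
  have gcl: "?g \<in> dsim n" "?g' \<in> dsim n" by (intro J_closed hp htp)+
  have egg: "(?e, dmult n ?g ?g') \<in> \<rho>"
    using rmult[OF eh eg'] by (simp add: J_mult p)
  \<comment> \<open>Because e absorbs this product from the left, \<open>Pd\<close> applies to the
    rank of the product itself, and minimality of r keeps that rank at r.\<close>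
  have "dmult n ?e ?g = ?g" by (rule J_mult_left[OF p p hp h])
  then have "dmult n ?e (dmult n ?g ?g') = dmult n ?g ?g'"
    using dmult_assoc[OF e gcl] by simp
  then have "r \<le> drank (dmult n ?g ?g')" using min[OF Pd[OF egg]] by simp
  then have "drank (dmult n ?g ?g') = r"
    using drank_mult_le(1)[OF gcl] J_rank[OF hp hp] by simp
  \<comment> \<open>Without loss of rank, h and h \<circ> t have the same kernel; but h merges i and
    j while h \<circ> t does not.\<close>
  from drank_mult_middle[OF hp hp htp htp this]
  obtain \<sigma> where \<sigma>: "\<forall>s\<in>{1..n}. (h \<circ> p) s = \<sigma> (((h \<circ> t) \<circ> p) s)" "\<sigma> permutes {1..r}" by blast
  have hs: "h x = \<sigma> (h (t x))" if x: "x \<in> {1..m}" for x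
    using onto_comp_eqD[OF p _ x, of h "\<lambda>x. \<sigma> (h (t x))"] \<sigma>(1) by simp
  have "\<sigma> (h (t i)) = \<sigma> (h (t j))" using hs ij by metis
  then have "h (t i) = h (t j)" using permutes_inj[OF \<sigma>(2)] by (simp add: inj_eq)
  moreover have "t i = i" "t j = l" using ij l by (auto simp: t_def transpose_def)
  ultimately show False using l by simp
qed

lemma rel_H:
  assumes m: "zrank < m" and p: "onto n m p" and q: "onto n m q" and ab: "(J n m p q, b) \<in> \<rho>"
  shows "\<exists>\<sigma>. \<sigma> permutes {1..m} \<and> b = J n m (\<sigma> \<circ> p) q"
proof -
  \<comment> \<open>Multiplying by the inverse of the first element reduces to
    \<open>rel_rank\<close> for an idempotent; the rank of the triple product bounds that of both
    partial products. The ranks stay arbitrary because the fact is used again with the two elements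
    exchanged.\<close>
  have ranks: "m' \<le> drank (dmult n (J n m' p p) b) \<and> m' \<le> drank (dmult n b (J n m' q p))"
    if m': "zrank < m'" and p: "onto n m' p" and q: "onto n m' q" and ab: "(J n m' p q, b) \<in> \<rho>" for m' p q b
  proof -
    let ?e = "J n m' p p" and ?a' = "J n m' q p"
    have cl: "?e \<in> dsim n" "b \<in> dsim n" "?a' \<in> dsim n"
      using J_closed[OF p p] J_closed[OF q p] rcl(2)[OF ab] by auto
    have "(dmult n (J n m' p q) ?a', dmult n b ?a') \<in> \<rho>" by (rule rright[OF ab cl(3)])
    then have "(?e, dmult n b ?a') \<in> \<rho>" by (simp add: J_mult p q)
    from rel_rank[OF m' p this] have r: "drank (dmult n ?e (dmult n b ?a')) = m'" .
    show ?thesis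
      using drank_mult_le(2)[OF cl(1) dmult_closed[OF cl(2,3)]]
        drank_mult_le(1)[OF dmult_closed[OF cl(1,2)] cl(3)] r dmult_assoc[OF cl] by simp
  qed
  note r = ranks[OF m p q ab]
  have bd: "b \<in> dsim n" using rcl(2)[OF ab] .
  have mb: "m \<le> drank b" using r drank_mult_le(2)[OF J_closed[OF p p] bd] by simp
  obtain p1 q1 where b1: "onto n (drank b) p1" "onto n (drank b) q1" "b = J n (drank b) p1 q1"
    by (rule dsim_J[OF bd])
  \<comment> \<open>Exchanging the roles bounds the rank of b from above, so the two ranks agree and
    \<open>drank_mult_middle\<close> can match both labellings.\<close>
  have "drank b \<le> drank (dmult n (J n (drank b) p1 p1) (J n m p q))"
    using ranks[of "drank b" p1 q1 "J n m p q"] b1 rsym[OF ab] m mb by simp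
  then have "drank b \<le> m"
    using drank_mult_le(2)[OF J_closed[OF b1(1,1)] J_closed[OF p q]] J_rank[OF p q] by simp
  then have bm: "drank b = m" using mb by simp
  obtain p' q' where b: "onto n m p'" "onto n m q'" "b = J n m p' q'" using b1 bm by metis
  have "drank (dmult n (J n m p p) (J n m p' q')) = m" "drank (dmult n (J n m p' q') (J n m q p)) = m"
    using r drank_mult_le(1)[OF J_closed[OF p p] bd] drank_mult_le(2)[OF bd J_closed[OF q p]]
      J_rank[OF p p] J_rank[OF q p] b(3) by simp_all
  then obtain \<sigma> \<tau> where \<sigma>: "\<sigma> permutes {1..m}" "\<forall>s\<in>{1..n}. p s = \<sigma> (p' s)"
    and \<tau>: "\<tau> permutes {1..m}" "\<forall>s\<in>{1..n}. q' s = \<tau> (q s)"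
    using drank_mult_middle[OF p p b(1,2)] drank_mult_middle[OF b(1,2) q p] by blast
  have "b = J n m (inv' \<sigma> \<circ> p) (\<tau> \<circ> q)"
    unfolding b(3) using \<sigma> \<tau> by (intro J_cong) (simp_all add: permutes_inverses)
  also have "\<dots> = J n m (inv' \<tau> \<circ> (inv' \<sigma> \<circ> p)) q"
    by (intro J_perm_right onto_perm_comp permutes_inv \<sigma> \<tau> p q)
  finally have "b = J n m ((inv' \<tau> \<circ> inv' \<sigma>) \<circ> p) q" by (simp add: o_assoc)
  moreover have "inv' \<tau> \<circ> inv' \<sigma> permutes {1..m}" by (intro permutes_compose permutes_inv \<sigma> \<tau>)
  ultimately show ?thesis by blast
qed

text \<open>Merging i and j gives related elements of rank m - 1. If that rank still exceeds
  \<open>zrank\<close>, they are H-related by \<open>rel_H\<close>, so the permutation respects the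
  merged pair; one that respects all pairs is trivial.\<close>

lemma rel_top:
  assumes m: "zrank < m" and p: "onto n m p" and q: "onto n m q" and \<sigma>: "\<sigma> permutes {1..m}"
    and ab: "(J n m p q, J n m (\<sigma> \<circ> p) q) \<in> \<rho>" and ne: "\<sigma> \<noteq> id"
  shows "m = zrank + 1"
proof (rule ccontr)
  assume "m \<noteq> zrank + 1"
  \<comment> \<open>Three labels are available because \<open>zrank\<close> is at least 1.\<close>
  then have m1: "zrank < m - 1" and m3: "3 \<le> m" using m zrank_bounds by auto
  note \<sigma>' = permutes_inv[OF \<sigma>]
  note sp = onto_perm_comp[OF \<sigma> p] and isp = onto_perm_comp[OF \<sigma>' p]
  have "(dmult n (J n m p q) (J n m q p), dmult n (J n m (\<sigma> \<circ> p) q) (J n m q p)) \<in> \<rho>"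
    by (rule rright[OF ab J_closed[OF q p]])
  then have e: "(J n m p p, J n m p (inv' \<sigma> \<circ> p)) \<in> \<rho>"
    by (simp add: J_mult p q sp J_perm_left[OF \<sigma> p p])
  have pair: "inv' \<sigma> i \<in> {i, j}" if ij: "i \<in> {1..m}" "j \<in> {1..m}" "i \<noteq> j" for i j
  proof -
    obtain h where h: "onto m (m - 1) h" "h i = h j"
      "\<And>a b. \<lbrakk>a \<in> {1..m}; b \<in> {1..m}; h a = h b; a \<noteq> b\<rbrakk> \<Longrightarrow> a \<in> {i, j} \<and> b \<in> {i, j}"
      using ex_merge[OF ij] by metis
    note hp = onto_comp[OF h(1) p] and hsp = onto_comp[OF h(1) isp]
    let ?f = "J n (m - 1) (h \<circ> p) (h \<circ> p)"
    have "(dmult n ?f (J n m p p), dmult n ?f (J n m p (inv' \<sigma> \<circ> p))) \<in> \<rho>"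
      by (rule rleft[OF e J_closed[OF hp hp]])
    then have "(?f, J n (m - 1) (h \<circ> p) (h \<circ> (inv' \<sigma> \<circ> p))) \<in> \<rho>"
      unfolding J_mult_right[OF hp p p h(1)] J_mult_right[OF hp p isp h(1)] .
    from rel_H[OF m1 hp hp this] obtain \<tau> where \<tau>: "\<tau> permutes {1..m - 1}"
      and eq: "J n (m - 1) (h \<circ> p) (h \<circ> (inv' \<sigma> \<circ> p)) = J n (m - 1) (\<tau> \<circ> (h \<circ> p)) (h \<circ> p)" by blast
    note eq' = eq[unfolded J_perm_left[OF \<tau> hp hp]]
    \<comment> \<open>Composing h with \<open>inv' \<sigma>\<close> only relabels its values, so
      images of merged labels are again merged, and {i, j} is the only merged pair.\<close>
    have hs: "h (inv' \<sigma> x) = inv' \<tau> (h x)" if x: "x \<in> {1..m}" for x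
      using onto_comp_eqD[OF p _ x, of "\<lambda>x. h (inv' \<sigma> x)" "\<lambda>x. inv' \<tau> (h x)"]
        J_eqD[OF hp hsp onto_perm_comp[OF permutes_inv[OF \<tau>] hp] eq'] by simp
    have "h (inv' \<sigma> i) = h (inv' \<sigma> j)" using hs ij h(2) by simp
    moreover have "inv' \<sigma> i \<in> {1..m}" "inv' \<sigma> j \<in> {1..m}"
      using ij unfolding permutes_in_image[OF \<sigma>'] by blast+
    moreover have "inv' \<sigma> i \<noteq> inv' \<sigma> j" using permutes_inj[OF \<sigma>'] ij(3) by (simp add: inj_eq)
    ultimately show ?thesis using h(3) by blast
  qed
  have "inv' \<sigma> i = i" if i: "i \<in> {1..m}" for i
  proof -
    have "\<not> {1..m} \<subseteq> A" if "finite A" "card A \<le> 2" for A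
      using m3 card_mono[OF that(1), of "{1..m}"] that(2) by auto
    then have ex: "\<exists>x\<in>{1..m}. x \<notin> A" if "finite A" "card A \<le> 2" for A
      using that by blast
    obtain j where j: "j \<in> {1..m}" "j \<noteq> i" using ex[of "{i}"] by auto
    \<comment> \<open>The pairs {i, j} and {i, l} meet only in i, which pins down the image of
      i.\<close>
    obtain l where l: "l \<in> {1..m}" "l \<noteq> i" "l \<noteq> j" using ex[of "{i, j}"] card_insert_le_m1[of 2 "{j}" i] by auto
    show ?thesis using pair[OF i j(1)] pair[OF i l(1)] j l by auto
  qed
  then have "inv' \<sigma> = id" by (intro permutes_eqI[OF \<sigma>' permutes_id]) simp
  then have "inv' (inv' \<sigma>) = inv' id" by simp
  then show False using ne by (simp add: permutes_inv_inv[OF \<sigma>])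
qed

text \<open>If \<open>zrank = n\<close>, there are no surjections onto \<open>{1..n + 1}\<close>, and \<open>nker\<close> is the whole
symmetric group.\<close>
definition nker :: "(nat \<Rightarrow> nat) set" where
  "nker = {\<sigma>. \<sigma> permutes {1..zrank + 1} \<and> (\<forall>p q. onto n (zrank + 1) p \<longrightarrow> onto n (zrank + 1) q \<longrightarrow>
     (J n (zrank + 1) p q, J n (zrank + 1) (\<sigma> \<circ> p) q) \<in> \<rho>)}"

text \<open>A single related pair suffices: multiplying by \<open>J n (zrank + 1) p' p\<close> on
  the left and \<open>J n (zrank + 1) q q'\<close> on the right moves it to any other labellings
  with the same \<sigma>.\<close>

lemma nkerI:
  assumes \<sigma>: "\<sigma> permutes {1..zrank + 1}" and p: "onto n (zrank + 1) p" and q: "onto n (zrank + 1) q"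
    and ab: "(J n (zrank + 1) p q, J n (zrank + 1) (\<sigma> \<circ> p) q) \<in> \<rho>"
  shows "\<sigma> \<in> nker"
proof -
  let ?m = "zrank + 1"
  have "(J n ?m p' q', J n ?m (\<sigma> \<circ> p') q') \<in> \<rho>" if p': "onto n ?m p'" and q': "onto n ?m q'" for p' q'
  proof -
    note sp = onto_perm_comp[OF \<sigma> p] and sp' = onto_perm_comp[OF \<sigma> p']
    have "(dmult n (dmult n (J n ?m p' p) (J n ?m p q)) (J n ?m q q'),
      dmult n (dmult n (J n ?m p' p) (J n ?m (\<sigma> \<circ> p) q)) (J n ?m q q')) \<in> \<rho>"
      by (intro rright rleft ab J_closed p q p' q')
    moreover have "dmult n (dmult n (J n ?m p' p) (J n ?m p q)) (J n ?m q q') = J n ?m p' q'"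
      by (simp only: J_mult p p' q q')
    moreover have "dmult n (dmult n (J n ?m p' p) (J n ?m (\<sigma> \<circ> p) q)) (J n ?m q q') = J n ?m (\<sigma> \<circ> p') q'"
      unfolding J_perm[OF \<sigma> p' p, symmetric] by (simp only: J_mult sp sp' q q')
    ultimately show ?thesis by simp
  qed
  then show ?thesis using \<sigma> by (simp add: nker_def)
qed

lemma nker_normal: "nker \<lhd> sym_group (zrank + 1)"
  unfolding sym_normal_iff
proof (intro conjI ballI allI impI)
  let ?m = "zrank + 1"
  have perm: "\<sigma> permutes {1..?m}" if "\<sigma> \<in> nker" for \<sigma> using that by (simp only: nker_def mem_Collect_eq)
  have rel: "(J n ?m p q, J n ?m (\<sigma> \<circ> p) q) \<in> \<rho>"
    if "\<sigma> \<in> nker" "onto n ?m p" "onto n ?m q" for \<sigma> p q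
    using that by (simp only: nker_def mem_Collect_eq)
  have I: "\<sigma> \<in> nker" if "\<sigma> permutes {1..?m}"
    "\<And>p q. \<lbrakk>onto n ?m p; onto n ?m q\<rbrakk> \<Longrightarrow> (J n ?m p q, J n ?m (\<sigma> \<circ> p) q) \<in> \<rho>" for \<sigma>
    using that unfolding nker_def mem_Collect_eq by blast
  show "nker \<subseteq> {p. p permutes {1..?m}}" using perm by blast
  show "id \<in> nker" using rrefl J_closed by (intro I permutes_id) simp
  show "s \<circ> t \<in> nker" if s: "s \<in> nker" and t: "t \<in> nker" for s t
  proof (rule I)
    show "s \<circ> t permutes {1..?m}" by (intro permutes_compose perm s t)
    fix p q assume pq: "onto n ?m p" "onto n ?m q"
    have "(J n ?m (t \<circ> p) q, J n ?m (s \<circ> (t \<circ> p)) q) \<in> \<rho>"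
      by (intro rel s onto_perm_comp perm t pq)
    then show "(J n ?m p q, J n ?m (s \<circ> t \<circ> p) q) \<in> \<rho>"
      unfolding o_assoc by (rule rtrans[OF rel[OF t pq]])
  qed
  show "inv' s \<in> nker" if s: "s \<in> nker" for s
  proof (rule I)
    note s' = permutes_inv[OF perm[OF s]]
    show "inv' s permutes {1..?m}" by (rule s')
    fix p q assume pq: "onto n ?m p" "onto n ?m q"
    have "(J n ?m (inv' s \<circ> p) q, J n ?m (s \<circ> (inv' s \<circ> p)) q) \<in> \<rho>"
      by (intro rel s onto_perm_comp s' pq)
    moreover have "s \<circ> (inv' s \<circ> p) = p" by (simp add: o_assoc permutes_inv_o(1)[OF perm[OF s]])
    ultimately show "(J n ?m p q, J n ?m (inv' s \<circ> p) q) \<in> \<rho>" using rsym by simp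
  qed
  show "t \<circ> s \<circ> inv' t \<in> nker" if s: "s \<in> nker" and t: "t permutes {1..?m}" for s t
  proof (rule I)
    note t' = permutes_inv[OF t] and sp = perm[OF s]
    show "t \<circ> s \<circ> inv' t permutes {1..?m}" by (intro permutes_compose t t' sp)
    fix p q assume pq: "onto n ?m p" "onto n ?m q"
    \<comment> \<open>Applying \<open>inv' t\<close> to both labellings describes the same element,
      but turns the action of s into that of its conjugate by t.\<close>
    note tp = onto_perm_comp[OF t' pq(1)] and tq = onto_perm_comp[OF t' pq(2)]
    have "(J n ?m (inv' t \<circ> p) (inv' t \<circ> q), J n ?m (s \<circ> (inv' t \<circ> p)) (inv' t \<circ> q)) \<in> \<rho>"
      by (rule rel[OF s tp tq])
    moreover have "J n ?m (inv' t \<circ> p) (inv' t \<circ> q) = J n ?m p q"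
      by (rule J_perm[OF t' pq])
    moreover have "J n ?m (s \<circ> (inv' t \<circ> p)) (inv' t \<circ> q) = J n ?m (t \<circ> (s \<circ> (inv' t \<circ> p))) q"
      by (rule J_perm_left[OF t onto_perm_comp[OF sp tp] pq(2), symmetric])
    ultimately show "(J n ?m p q, J n ?m (t \<circ> s \<circ> inv' t \<circ> p) q) \<in> \<rho>" by (simp only: o_assoc)
  qed
qed

lemma eq_rho: "\<rho> = rho n zrank nker"
proof (intro equalityI subsetI)
  fix ab assume "ab \<in> \<rho>"
  then obtain a b where abp: "ab = (a, b)" and ab: "(a, b) \<in> \<rho>" by (cases ab) auto
  have a: "a \<in> dsim n" using rcl ab by blast
  show "ab \<in> rho n zrank nker"
  proof (cases "a \<in> Zcl")
    case True
    then show ?thesis using Zcl_rel[OF ab] unfolding abp rho_def Zcl_eq by blast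
  next
    case False
    let ?m = "drank a"
    have m: "zrank < ?m" using False a by (simp add: Zcl_eq Ideal_k_def)
    obtain p q where pq: "onto n ?m p" "onto n ?m q" "a = J n ?m p q" by (rule dsim_J[OF a])
    have ab': "(J n ?m p q, b) \<in> \<rho>" using ab pq(3) by simp
    obtain \<sigma> where \<sigma>: "\<sigma> permutes {1..?m}" "b = J n ?m (\<sigma> \<circ> p) q"
      using rel_H[OF m pq(1,2) ab'] by blast
    show ?thesis
    proof (cases "\<sigma> = id")
      case True
      then have "a = b" using \<sigma>(2) pq(3) by simp
      then show ?thesis using a unfolding abp rho_def by blast
    next
      case False
      have ab'': "(J n ?m p q, J n ?m (\<sigma> \<circ> p) q) \<in> \<rho>" using ab' \<sigma>(2) by simp
      have m1: "?m = zrank + 1" by (rule rel_top[OF m pq(1,2) \<sigma>(1) ab'' False])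
      note f = pq[unfolded m1] \<sigma>[unfolded m1] ab''[unfolded m1]
      have "\<sigma> \<in> nker" by (rule nkerI[OF f(4) f(1,2) f(6)])
      then have "(a, b) \<in> Frel n zrank nker" unfolding Frel_J[OF nker_normal] using f by blast
      then show ?thesis unfolding abp rho_def by blast
    qed
  qed
next
  fix ab assume "ab \<in> rho n zrank nker"
  then consider "ab \<in> Id_on (dsim n)" | "ab \<in> Frel n zrank nker" | "ab \<in> Zcl \<times> Zcl"
    unfolding rho_def Zcl_eq by blast
  then show "ab \<in> \<rho>"
  proof cases
    case 1
    then show ?thesis using rrefl by (auto simp: Id_on_def)
  next
    case 2
    obtain a b where abp: "ab = (a, b)" by (cases ab)
    then obtain p q \<sigma> where "onto n (zrank + 1) p" "onto n (zrank + 1) q" "\<sigma> \<in> nker"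
      "a = J n (zrank + 1) p q" "b = J n (zrank + 1) (\<sigma> \<circ> p) q"
      using 2 unfolding abp Frel_J[OF nker_normal] by blast
    then show ?thesis unfolding abp by (simp only: nker_def mem_Collect_eq)
  next
    case 3
    then show ?thesis using rtrans rsym unfolding Zcl_def by blast
  qed
qed

end

theorem mainTheorem7:
  fixes n :: nat and \<rho> :: "(dpart \<times> dpart) set"
  assumes "n \<ge> 1" and "\<rho> \<subseteq> dsim n \<times> dsim n"
  shows "dcongruence n \<rho> \<longleftrightarrow>
    (\<exists>k A. 1 \<le> k \<and> k \<le> n \<and> A \<lhd> sym_group (k + 1) \<and> \<rho> = rho n k A)"
proof
  assume "dcongruence n \<rho>"
  then interpret dcong n \<rho> using assms(1) by unfold_locales
  show "\<exists>k A. 1 \<le> k \<and> k \<le> n \<and> A \<lhd> sym_group (k + 1) \<and> \<rho> = rho n k A"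
    using zrank_bounds nker_normal eq_rho by blast
next
  assume "\<exists>k A. 1 \<le> k \<and> k \<le> n \<and> A \<lhd> sym_group (k + 1) \<and> \<rho> = rho n k A"
  then show "dcongruence n \<rho>" using rho_congruence by blast
qed

end
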